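(* Let $n\geq1$, $-1<s<\frac n4$ and $1\leq p\leq\frac{n+2}{2s+2}$. If $$\frac1p>\frac{4s+2}{n+2}\quad\text{and}\quad\frac1p>2s,$$ then the estimate $$\|e^{it\Delta}f\|_{L^2_{x,t}(w(x,t))}\leq C\,\|w\|_{\mathfrak{L}^{2s+2,p}_2}^{1/2}\,\|f\|_{\dot H^s}$$ is false, i.e. there is no finite constant $C$ for which it holds for all weights $w\in\mathfrak{L}^{2s+2,p}_2$ and all $f\in\dot H^s(\mathbb{R}^n)$.
   Context: For $f$ on $\mathbb{R}^n$, $e^{it\Delta}f(x)=(2\pi)^{-n}\int_{\mathbb{R}^n}e^{ix\cdot\xi}e^{-it|\xi|^2}\widehat f(\xi)\,d\xi$. $\|f\|_{\dot H^s}=\|(-\Delta)^{s/2}f\|_{L^2}$ is the homogeneous Sobolev norm. For a nonnegative measurable function (weight) $w$ on $\mathbb{R}^{n+1}$, $L^2_{x,t}(w)=L^2(\mathbb{R}^{n+1},w\,dx\,dt)$. For $\gamma\geq1$, $\alpha>0$, $1\leq p\leq\frac{n+\gamma}{\alpha}$, $\mathfrak{L}^{\alpha,p}_\gamma$ is the class of weights $w\ge 0$ on $\mathbb{R}^{n+1}$ with finite norm $$\|w\|_{\mathfrak{L}^{\alpha,p}_\gamma}=\sup_{(x,t)\in\mathbb{R}^{n+1},\,r>0}r^\alpha\Big(\frac1{r^{n+\gamma}}\int_{Q(x,r)\times I(t,r^\gamma)}w(y,\tau)^p\,dy\,d\tau\Big)^{1/p},$$ where $Q(x,r)$ is the cube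 in $\mathbb{R}^n$ centered at $x$ with side length $r$ and $I(t,r^\gamma)$ is the interval in $\mathbb{R}$ centered at $t$ with length $r^\gamma$. Here $\gamma=2$. *)

theory Defs
  imports "HOL-Analysis.Analysis"
begin

section \<open>Schwartz functions and tempered distributions\<close>

fun iterated_partial :: "'n list \<Rightarrow> (real^'n \<Rightarrow> complex) \<Rightarrow> real^'n \<Rightarrow> complex" where
  "iterated_partial [] \<phi> = \<phi>"
| "iterated_partial (j # js) \<phi> =
     (\<lambda>x. frechet_derivative (iterated_partial js \<phi>) (at x) (axis j 1))"

definition smooth :: "(real^'n \<Rightarrow> complex) \<Rightarrow> bool" where
  "smooth \<phi> \<longleftrightarrow> (\<forall>js. iterated_partial js \<phi> differentiable_on UNIV)"

definition test_functions :: "(real^'n \<Rightarrow> complex) set" where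
  "test_functions = {\<phi>. smooth \<phi> \<and> compact (closure {x. \<phi> x \<noteq> 0})}"

definition schwartz_functions :: "(real^'n \<Rightarrow> complex) set" where
  "schwartz_functions = {\<phi>. smooth \<phi> \<and>
     (\<forall>(k::nat) js. bounded (range (\<lambda>x. (1 + norm x) ^ k * cmod (iterated_partial js \<phi> x))))}"

text \<open>The supremum is a genuine one on Schwartz functions, where the family is bounded.\<close>

definition schwartz_seminorm :: "nat \<Rightarrow> (real^'n \<Rightarrow> complex) \<Rightarrow> real" where
  "schwartz_seminorm N \<phi> =
     (SUP (js, x) \<in> {js. length js \<le> N} \<times> UNIV. (1 + norm x) ^ N * cmod (iterated_partial js \<phi> x))"

text \<open>A tempered distribution is a functional on all functions of which only the values on
  Schwartz functions matter.\<close>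

definition tempered_distribution :: "((real^'n \<Rightarrow> complex) \<Rightarrow> complex) \<Rightarrow> bool" where
  "tempered_distribution f \<longleftrightarrow>
     (\<forall>\<phi>\<in>schwartz_functions. \<forall>\<psi>\<in>schwartz_functions. f (\<lambda>x. \<phi> x + \<psi> x) = f \<phi> + f \<psi>) \<and>
     (\<forall>c. \<forall>\<phi>\<in>schwartz_functions. f (\<lambda>x. c * \<phi> x) = c * f \<phi>) \<and>
     (\<exists>C N. \<forall>\<phi>\<in>schwartz_functions. cmod (f \<phi>) \<le> C * schwartz_seminorm N \<phi>)"

text \<open>The distribution \<open>f\<close> is (given by) the locally integrable function \<open>u\<close>.\<close>

definition represented_by ::
    "((real^'n \<Rightarrow> complex) \<Rightarrow> complex) \<Rightarrow> (real^'n \<Rightarrow> complex) \<Rightarrow> bool" where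
  "represented_by f u \<longleftrightarrow> u \<in> borel_measurable lebesgue \<and>
     (\<forall>\<phi>\<in>test_functions. integrable lebesgue (\<lambda>x. u x * \<phi> x) \<and>
        f \<phi> = (LINT x|lebesgue. u x * \<phi> x))"


section \<open>Fourier transform and Fourier multipliers\<close>

definition fourier :: "(real^'n \<Rightarrow> complex) \<Rightarrow> real^'n \<Rightarrow> complex" where
  "fourier \<phi> \<xi> = (LINT x|lebesgue. cis (- (x \<bullet> \<xi>)) * \<phi> x)"

definition inv_fourier :: "(real^'n \<Rightarrow> complex) \<Rightarrow> real^'n \<Rightarrow> complex" where
  "inv_fourier \<phi> x =
     complex_of_real (1 / (2 * pi) ^ CARD('n)) * (LINT \<xi>|lebesgue. cis (x \<bullet> \<xi>) * \<phi> \<xi>)"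

definition dist_fourier ::
    "((real^'n \<Rightarrow> complex) \<Rightarrow> complex) \<Rightarrow> (real^'n \<Rightarrow> complex) \<Rightarrow> complex" where
  "dist_fourier f = (\<lambda>\<phi>. f (fourier \<phi>))"

text \<open>The distributional inverse Fourier transform of the function \<open>G\<close> is the function \<open>u\<close>.
  The integrability requirement makes the pairing with \<open>G\<close> meaningful; without it the Bochner
  integral would silently be \<open>0\<close>.\<close>

definition inv_fourier_represented_by :: "(real^'n \<Rightarrow> complex) \<Rightarrow> (real^'n \<Rightarrow> complex) \<Rightarrow> bool" where
  "inv_fourier_represented_by G u \<longleftrightarrow>
     (\<forall>\<phi>\<in>test_functions. integrable lebesgue (\<lambda>\<xi>. G \<xi> * inv_fourier \<phi> \<xi>)) \<and>
     represented_by (\<lambda>\<phi>. LINT \<xi>|lebesgue. G \<xi> * inv_fourier \<phi> \<xi>) u"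

text \<open>\<open>u\<close> is the image of \<open>f\<close> under the Fourier multiplier with symbol \<open>m\<close>: the Fourier transform
  of \<open>f\<close> is a function \<open>g\<close>, and \<open>u\<close> is the inverse Fourier transform of \<open>m g\<close>.  A relation, since
  \<open>m(D) f\<close> may fail to be a function; \<open>g\<close> and \<open>u\<close> are unique up to null sets.\<close>

definition fourier_multiplier ::
    "(real^'n \<Rightarrow> complex) \<Rightarrow> ((real^'n \<Rightarrow> complex) \<Rightarrow> complex) \<Rightarrow> (real^'n \<Rightarrow> complex) \<Rightarrow> bool" where
  "fourier_multiplier m f u \<longleftrightarrow>
     (\<exists>g. represented_by (dist_fourier f) g \<and> inv_fourier_represented_by (\<lambda>\<xi>. m \<xi> * g \<xi>) u)"

text \<open>\<open>u = (-\<Delta>)\<^sup>s\<^sup>/\<^sup>2 f\<close>\<close>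

definition laplacian_half_power ::
    "real \<Rightarrow> ((real^'n \<Rightarrow> complex) \<Rightarrow> complex) \<Rightarrow> (real^'n \<Rightarrow> complex) \<Rightarrow> bool" where
  "laplacian_half_power s = fourier_multiplier (\<lambda>\<xi>. complex_of_real (norm \<xi> powr s))"

text \<open>\<open>u(x,t) = e\<^sup>i\<^sup>t\<^sup>\<Delta> f(x)\<close>, as a measurable function on space-time.  Asked for almost every \<open>t\<close> only:
  for negative \<open>s\<close> the distribution \<open>e\<^sup>i\<^sup>t\<^sup>\<Delta> f\<close> can fail to be a function at exceptional times.\<close>

definition schroedinger_evolution ::
    "((real^'n \<Rightarrow> complex) \<Rightarrow> complex) \<Rightarrow> ((real^'n) \<times> real \<Rightarrow> complex) \<Rightarrow> bool" where
  "schroedinger_evolution f u \<longleftrightarrow> u \<in> borel_measurable lebesgue \<and>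
     (AE t in lebesgue. fourier_multiplier (\<lambda>\<xi>. cis (- (t * (norm \<xi>)\<^sup>2))) f (\<lambda>x. u (x, t)))"


section \<open>Norms\<close>

definition ennreal_powr :: "ennreal \<Rightarrow> real \<Rightarrow> ennreal" where
  "ennreal_powr a q = (if a = \<infinity> then \<infinity> else ennreal (enn2real a powr q))"

definition L2_norm :: "'a measure \<Rightarrow> ('a \<Rightarrow> complex) \<Rightarrow> ennreal" where
  "L2_norm M u = ennreal_powr (\<integral>\<^sup>+ z. ennreal ((cmod (u z))\<^sup>2) \<partial>M) (1/2)"

text \<open>\<open>u\<close> is unique up to null sets, so the infimum is over at most one value; it is \<open>\<infinity>\<close> if
  \<open>(-\<Delta>)\<^sup>s\<^sup>/\<^sup>2 f\<close> is not a function.\<close>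

definition sobolev_norm :: "real \<Rightarrow> ((real^'n \<Rightarrow> complex) \<Rightarrow> complex) \<Rightarrow> ennreal" where
  "sobolev_norm s f = (INF u \<in> {u. laplacian_half_power s f u}. L2_norm lebesgue u)"

definition sobolev_space :: "real \<Rightarrow> ((real^'n \<Rightarrow> complex) \<Rightarrow> complex) set" where
  "sobolev_space s = {f. tempered_distribution f \<and> sobolev_norm s f < \<infinity>}"

definition cube :: "real^'n \<Rightarrow> real \<Rightarrow> (real^'n) set" where
  "cube x r = {y. \<forall>i. \<bar>y $ i - x $ i\<bar> \<le> r / 2}"

definition interval :: "real \<Rightarrow> real \<Rightarrow> real set" where
  "interval t l = {\<tau>. \<bar>\<tau> - t\<bar> \<le> l / 2}"

definition morrey_norm :: "real \<Rightarrow> real \<Rightarrow> real \<Rightarrow> ((real^'n) \<times> real \<Rightarrow> real) \<Rightarrow> ennreal" where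
  "morrey_norm \<gamma> \<alpha> p w =
     (SUP (x, t, r) \<in> UNIV \<times> UNIV \<times> {0<..}.
        ennreal (r powr \<alpha>) *
        ennreal_powr
          (ennreal (1 / r powr (real CARD('n) + \<gamma>)) *
           (\<integral>\<^sup>+ z \<in> cube x r \<times> interval t (r powr \<gamma>). ennreal (w z powr p) \<partial>lebesgue))
          (1 / p))"

definition morrey_class :: "real \<Rightarrow> real \<Rightarrow> real \<Rightarrow> ((real^'n) \<times> real \<Rightarrow> real) set" where
  "morrey_class \<gamma> \<alpha> p =
     {w. w \<in> borel_measurable lebesgue \<and> (\<forall>z. 0 \<le> w z) \<and> morrey_norm \<gamma> \<alpha> p w < \<infinity>}"

end

(* The counterexample is a Knapp wave packet.  Let the Fourier transform of f be the indicator of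
   a cube of side 1/n around N e, where e is a unit coordinate vector.  For |t| <= 1 the phase
   x . xi - t |xi|^2 varies by at most 1 over that cube as long as |x_i - 2 t N e_i| <= 1 for
   all i, so the evolution is bounded below, uniformly in N, on this tilted tube of measure
   2^(n+1), whereas the Sobolev norm of f is O(N^s).  With w the indicator of the tube, the p-th
   power of the Morrey norm is O(1/N + N^(-(s+1)p) + N^((2s+2)p-n-2)): the slope of the tube
   confines the times at which it meets a cube of side r to an interval of length (r+2)/(2N).
   The two hypotheses (and s < 1, which they imply) say exactly that N^(2sp) times each of the
   three terms tends to 0 as N grows. *)
theory Submission
  imports Defs "HOL-Probability.Sinc_Integral" "HOL-Probability.Characteristic_Functions"
begin

section \<open>Gaussians on Euclidean space\<close>

text \<open>The estimate speaks of tempered distributions, and this shapes the analytic half. The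
  datum \<open>f\<close> is the inverse transform of an indicator, a bounded function that is not
  integrable, so that its transform is this indicator cannot be read off from a pointwise inversion
  formula. It is checked against test functions, as a Parseval identity: a Gaussian factor is
  inserted, Fubini's theorem applied, and the factor removed in the limit. The evolution and the
  fractional Laplacian cause no such trouble, being inverse transforms of integrable functions.

  The Sobolev norm is needed only from above, and \<open>norm \<xi> powr s\<close> varies on the
  frequency cube by at most a factor independent of \<open>N\<close>. Bounding the squared
  \<open>L2\<close> norm by supremum times \<open>L1\<close> norm therefore costs only a constant.

  Why the packet must move: a Galilean boost leaves its size on the tube unchanged, but a packet of
  speed \<open>2 N\<close> crosses a unit cube in time about \<open>1 / N\<close>, where a packet at
  rest would stay for unit time. This is what makes the Morrey norm of the tube small.\<close>

interpretation lborel_product: product_sigma_finite "\<lambda>_::'a::euclidean_space. lborel :: real measure"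
  by standard

section \<open>Lebesgue integrals of products over the coordinates and under affine maps\<close>

lemma
  fixes f :: "'a::euclidean_space \<Rightarrow> real \<Rightarrow> 'b::{real_normed_field, banach, second_countable_topology}"
  assumes f: "\<And>b. b \<in> Basis \<Longrightarrow> integrable lborel (f b)"
  shows integrable_lborel_prod: "integrable lborel (\<lambda>x. \<Prod>b\<in>Basis. f b (x \<bullet> b))"
    and integral_lborel_prod:
      "(\<integral>x. (\<Prod>b\<in>Basis. f b (x \<bullet> b)) \<partial>lborel) = (\<Prod>b\<in>Basis. integral\<^sup>L lborel (f b))"
proof -
  let ?P = "\<Pi>\<^sub>M b\<in>(Basis :: 'a set). (lborel :: real measure)"
  have [measurable]: "\<And>b. b \<in> Basis \<Longrightarrow> f b \<in> borel_measurable borel"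
    using borel_measurable_integrable[OF f] by simp
  have g: "(\<lambda>x::'a. \<Prod>b\<in>Basis. f b (x \<bullet> b)) \<in> borel_measurable borel"
    by measurable
  have T: "(\<lambda>g. \<Sum>b\<in>Basis. g b *\<^sub>R b) \<in> ?P \<rightarrow>\<^sub>M (borel :: 'a measure)"
    by measurable
  have eq: "(\<Prod>b\<in>Basis. f b ((\<Sum>c\<in>Basis. g c *\<^sub>R c) \<bullet> b)) = (\<Prod>b\<in>(Basis::'a set). f b (g b))" for g
    by (intro prod.cong refl) simp
  show "integrable lborel (\<lambda>x. \<Prod>b\<in>Basis. f b (x \<bullet> b))"
  proof (subst lborel_eq, subst integrable_distr_eq[OF T g], subst eq)
    show "integrable ?P (\<lambda>g. \<Prod>b\<in>Basis. f b (g b))"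
      by (rule lborel_product.product_integrable_prod) (use f in auto)
  qed
  show "(\<integral>x. (\<Prod>b\<in>Basis. f b (x \<bullet> b)) \<partial>lborel) = (\<Prod>b\<in>Basis. integral\<^sup>L lborel (f b))"
  proof (subst lborel_eq, subst integral_distr[OF T g], subst eq)
    show "(\<integral>g. (\<Prod>b\<in>Basis. f b (g b)) \<partial>?P) = (\<Prod>b\<in>Basis. integral\<^sup>L lborel (f b))"
      by (rule lborel_product.product_integral_prod) (use f in auto)
  qed
qed

lemma nn_integral_lborel_affine:
  fixes f :: "'a::euclidean_space \<Rightarrow> ennreal"
  assumes c: "c \<noteq> 0" and [measurable]: "f \<in> borel_measurable borel"
  shows "integral\<^sup>N lborel f = ennreal (\<bar>c\<bar> ^ DIM('a)) * (\<integral>\<^sup>+x. f (t + c *\<^sub>R x) \<partial>lborel)"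
  by (subst lborel_affine[OF c, of t])
    (simp add: nn_integral_density nn_integral_distr nn_integral_cmult ennreal_power)

lemma
  fixes f :: "'a::euclidean_space \<Rightarrow> 'b::{banach, second_countable_topology}"
  assumes c: "c \<noteq> 0" and f: "integrable lborel f"
  shows integrable_lborel_affine: "integrable lborel (\<lambda>x. f (t + c *\<^sub>R x))"
    and integral_lborel_affine:
      "integral\<^sup>L lborel f = \<bar>c\<bar> ^ DIM('a) *\<^sub>R (\<integral>x. f (t + c *\<^sub>R x) \<partial>lborel)"
proof -
  note [measurable] = borel_measurable_integrable[OF f, simplified]
  have "(\<integral>\<^sup>+x. ennreal (norm (f x)) \<partial>lborel) < \<infinity>"
    using f by (simp add: integrable_iff_bounded)
  then have "(\<integral>\<^sup>+x. ennreal (norm (f (t + c *\<^sub>R x))) \<partial>lborel) < \<infinity>"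
    using c by (subst (asm) nn_integral_lborel_affine[OF c, of _ t])
      (auto simp: ennreal_mult_less_top)
  then show i: "integrable lborel (\<lambda>x. f (t + c *\<^sub>R x))"
    by (simp add: integrable_iff_bounded)
  have "integral\<^sup>L (density (distr lborel borel (\<lambda>x. t + c *\<^sub>R x)) (\<lambda>_. ennreal (\<bar>c\<bar> ^ DIM('a)))) f
      = \<bar>c\<bar> ^ DIM('a) *\<^sub>R (\<integral>x. f (t + c *\<^sub>R x) \<partial>lborel)"
    using i by (subst integral_density) (simp_all add: integral_distr)
  then show "integral\<^sup>L lborel f = \<bar>c\<bar> ^ DIM('a) *\<^sub>R (\<integral>x. f (t + c *\<^sub>R x) \<partial>lborel)"
    using lborel_affine[OF c, of t] by (simp add: ennreal_power)
qed

text \<open>The variance is chosen so that the Fourier transform reproduces the function up to a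
  factor. The value at 0, and not the integral, is normalised: \<open>gauss\<close> serves as a
  damping factor tending to 1, and its total mass \<open>sqrt (2 * pi) ^ d\<close> reappears as a
  constant.\<close>

definition gauss :: "'a::euclidean_space \<Rightarrow> real" where
  "gauss x = exp (- (norm x)\<^sup>2 / 2)"

lemma gauss_measurable [measurable]: "gauss \<in> borel_measurable borel"
  unfolding gauss_def by measurable

lemma gauss_nonneg: "0 \<le> gauss x" and gauss_le_1: "gauss x \<le> 1" and gauss_0: "gauss 0 = 1"
  by (auto simp: gauss_def)

lemma gauss_minus: "gauss (- x) = gauss x"
  by (simp add: gauss_def)

lemma gauss_prod: "gauss x = (\<Prod>b\<in>Basis. exp (- (x \<bullet> b)\<^sup>2 / 2))"
  unfolding gauss_def
  by (simp add: exp_sum[symmetric] sum_negf sum_divide_distrib[symmetric] power2_norm_eq_inner)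
    (simp add: euclidean_inner[of x x] power2_eq_square)

lemma std_normal_density_exp: "exp (- x\<^sup>2 / 2) = sqrt (2 * pi) * std_normal_density x"
  by (simp add: std_normal_density_def)

lemma integrable_gauss_real: "integrable lborel (\<lambda>x::real. exp (- x\<^sup>2 / 2))"
  unfolding std_normal_density_exp using integrable_std_normal_moment[of 0] by simp

text \<open>This is the characteristic function of the standard normal distribution with the density
  unnormalised.\<close>

lemma integral_cis_gauss_real:
  "(\<integral>x. cis (x * y) * complex_of_real (exp (- x\<^sup>2 / 2)) \<partial>lborel)
    = complex_of_real (sqrt (2 * pi) * exp (- y\<^sup>2 / 2))"
proof -
  have "(\<integral>x. std_normal_density x *\<^sub>R cis (y * x) \<partial>lborel) = char std_normal_distribution y"
    unfolding char_def by (subst integral_density) (auto simp: cis_conv_exp)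
  also have "\<dots> = complex_of_real (exp (- y\<^sup>2 / 2))"
    by (simp add: char_std_normal_distribution)
  finally show ?thesis
    by (simp add: std_normal_density_def scaleR_conv_of_real mult.commute field_simps)
qed

lemma integrable_gauss: "integrable lborel (gauss :: 'a::euclidean_space \<Rightarrow> real)"
  unfolding gauss_prod using integrable_gauss_real by (rule integrable_lborel_prod)

lemma cis_sum: "cis (\<Sum>i\<in>A. f i) = (\<Prod>i\<in>A. cis (f i))"
  by (induction A rule: infinite_finite_induct) (auto simp: cis_mult[symmetric])

lemma cis_measurable [measurable]: "cis \<in> borel_measurable borel"
  by (intro borel_measurable_continuous_onI continuous_intros)

lemma integral_cis_gauss:
  "(\<integral>x. cis (x \<bullet> y) * complex_of_real (gauss x) \<partial>lborel)
    = complex_of_real (sqrt (2 * pi) ^ DIM('a) * gauss (y::'a::euclidean_space))"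
proof -
  have "(\<integral>x. cis (x \<bullet> y) * complex_of_real (gauss x) \<partial>lborel) =
    (\<integral>x. (\<Prod>b\<in>Basis. cis ((x \<bullet> b) * (y \<bullet> b)) * complex_of_real (exp (- (x \<bullet> b)\<^sup>2 / 2))) \<partial>lborel)"
    by (intro Bochner_Integration.integral_cong refl)
      (simp add: gauss_prod euclidean_inner[of _ y] cis_sum prod.distrib)
  also have "\<dots> = (\<Prod>b\<in>Basis. complex_of_real (sqrt (2 * pi) * exp (- (y \<bullet> b)\<^sup>2 / 2)))"
  proof (subst integral_lborel_prod)
    fix b :: 'a
    show "integrable lborel (\<lambda>x. cis (x * (y \<bullet> b)) * complex_of_real (exp (- x\<^sup>2 / 2)))"
      by (rule Bochner_Integration.integrable_bound[OF integrable_gauss_real]) (auto simp: norm_mult)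
  qed (simp only: integral_cis_gauss_real)
  finally show ?thesis
    by (simp add: prod.distrib gauss_prod)
qed

section \<open>Fourier integrals of bounded integrable functions\<close>

text \<open>The sign \<open>\<sigma>\<close> treats the transform (\<open>-1\<close>) and the
  unnormalised inverse transform (\<open>1\<close>) together; conjugation exchanges them.\<close>

definition fourier_integral :: "real \<Rightarrow> ('a::euclidean_space \<Rightarrow> complex) \<Rightarrow> 'a \<Rightarrow> complex" where
  "fourier_integral \<sigma> g x = (\<integral>y. cis (\<sigma> * (x \<bullet> y)) * g y \<partial>lborel)"

lemma fourier_integral_measurable [measurable]:
  fixes g :: "'a::euclidean_space \<Rightarrow> complex"
  assumes [measurable]: "g \<in> borel_measurable borel"
  shows "fourier_integral \<sigma> g \<in> borel_measurable borel"
proof -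
  have [simp]: "(\<lambda>x. fourier_integral \<sigma> g x) \<in> borel_measurable lborel"
    unfolding fourier_integral_def by measurable
  then show ?thesis by simp
qed

lemma integrable_cis_mult:
  assumes "integrable M g" and [measurable]: "h \<in> borel_measurable M"
  shows "integrable M (\<lambda>x. cis (h x) * g x)"
proof -
  have [measurable]: "g \<in> borel_measurable M"
    using assms(1) by simp
  show ?thesis
    by (rule Bochner_Integration.integrable_bound[OF assms(1)]) (auto simp: norm_mult)
qed

lemma norm_fourier_integral_le:
  fixes g :: "'a::euclidean_space \<Rightarrow> complex"
  assumes "integrable lborel g"
  shows "norm (fourier_integral \<sigma> g x) \<le> (\<integral>y. norm (g y) \<partial>lborel)"
  unfolding fourier_integral_def
  by (rule order_trans[OF integral_norm_bound]) (simp add: norm_mult)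

lemma fourier_integral_cnj:
  "cnj (fourier_integral \<sigma> g x) = fourier_integral (- \<sigma>) (\<lambda>y. cnj (g y)) x"
  unfolding fourier_integral_def by (subst Bochner_Integration.integral_cnj[symmetric])
    (simp only: complex_cnj_mult cis_cnj mult_minus_left)

text \<open>The multiplication formula: the phase has modulus one, so the double integral is
  dominated by the product of the two \<open>L1\<close> norms and Fubini applies. The kernel is
  symmetric, whence the same transform on both sides.\<close>

lemma fourier_integral_exchange:
  fixes a b :: "'a::euclidean_space \<Rightarrow> complex"
  assumes a: "integrable lborel a" and b: "integrable lborel b"
  shows "(\<integral>x. a x * fourier_integral \<sigma> b x \<partial>lborel) = (\<integral>y. fourier_integral \<sigma> a y * b y \<partial>lborel)"
proof -
  have [measurable]: "a \<in> borel_measurable borel" "b \<in> borel_measurable borel"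
    using a b by (auto dest: borel_measurable_integrable)
  let ?f = "\<lambda>x y. cis (\<sigma> * (x \<bullet> y)) * a x * b y"
  have "integrable (lborel \<Otimes>\<^sub>M lborel) (case_prod ?f)"
  proof (rule lborel_pair.Fubini_integrable)
    have "integrable lborel (\<lambda>x. norm (a x) * (\<integral>y. norm (b y) \<partial>lborel))"
      using a by simp
    then show "integrable lborel (\<lambda>x. \<integral>y. norm (case (x, y) of (x, y) \<Rightarrow> ?f x y) \<partial>lborel)"
      by (simp add: norm_mult)
    show "AE x in lborel. integrable lborel (\<lambda>y. case (x, y) of (x, y) \<Rightarrow> ?f x y)"
      using b by (auto intro!: AE_I2 integrable_cis_mult simp: mult.assoc)
  qed measurable
  then have "(\<integral>y. (\<integral>x. ?f x y \<partial>lborel) \<partial>lborel) = (\<integral>x. (\<integral>y. ?f x y \<partial>lborel) \<partial>lborel)"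
    by (rule lborel_pair.Fubini_integral)
  moreover have "(\<integral>y. ?f x y \<partial>lborel) = a x * fourier_integral \<sigma> b x" for x
    unfolding fourier_integral_def by (subst integral_mult_right_zero[symmetric]) (simp add: ac_simps)
  moreover have "(\<integral>x. ?f x y \<partial>lborel) = fourier_integral \<sigma> a y * b y" for y
    unfolding fourier_integral_def by (subst integral_mult_left_zero[symmetric]) (simp add: inner_commute)
  ultimately show ?thesis
    by (simp only:)
qed

lemma integrable_gauss_scale:
  "\<epsilon> \<noteq> 0 \<Longrightarrow> integrable lborel (\<lambda>x::'a::euclidean_space. gauss (\<epsilon> *\<^sub>R x))"
  using integrable_lborel_affine[OF _ integrable_gauss, of \<epsilon> 0] by simp

lemma fourier_integral_gauss_scale:
  fixes y :: "'a::euclidean_space"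
  assumes "\<epsilon> > 0"
  shows "fourier_integral 1 (\<lambda>x. complex_of_real (gauss (\<epsilon> *\<^sub>R x))) y
    = complex_of_real (sqrt (2 * pi) ^ DIM('a) / \<epsilon> ^ DIM('a) * gauss (y /\<^sub>R \<epsilon>))"
proof -
  have "integrable lborel (\<lambda>x::'a. complex_of_real (gauss (\<epsilon> *\<^sub>R x)))"
    using integrable_gauss_scale[of \<epsilon>] assms by (simp add: complex_of_real_integrable_eq)
  then have i: "integrable lborel (\<lambda>x. cis (1 * (y \<bullet> x)) * complex_of_real (gauss (\<epsilon> *\<^sub>R x)))"
    by (rule integrable_cis_mult) simp
  have "fourier_integral 1 (\<lambda>x. complex_of_real (gauss (\<epsilon> *\<^sub>R x))) y
     = \<bar>inverse \<epsilon>\<bar> ^ DIM('a) *\<^sub>R (\<integral>x. cis (x \<bullet> (y /\<^sub>R \<epsilon>)) * complex_of_real (gauss x) \<partial>lborel)"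
    unfolding fourier_integral_def
    using assms by (subst integral_lborel_affine[OF _ i, of "inverse \<epsilon>" 0]) (simp_all add: inner_commute)
  also note integral_cis_gauss
  finally show ?thesis
    using assms by (simp add: scaleR_conv_of_real power_inverse divide_inverse)
qed

text \<open>Up to the factor \<open>sqrt (2 * pi) ^ d\<close>, the convolution of
  \<open>\<phi>\<close> with the normal density of standard deviation \<open>\<epsilon>\<close>.
  Keeping \<open>\<epsilon>\<close> in the argument of \<open>\<phi>\<close> gives a majorant, a
  multiple of \<open>gauss\<close>, that does not depend on \<open>\<epsilon>\<close>.\<close>

definition gauss_smoothing :: "real \<Rightarrow> ('a::euclidean_space \<Rightarrow> complex) \<Rightarrow> 'a \<Rightarrow> complex" where
  "gauss_smoothing \<epsilon> \<phi> x = (\<integral>z. \<phi> (x + \<epsilon> *\<^sub>R z) * complex_of_real (gauss z) \<partial>lborel)"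

text \<open>The Gaussian makes the bounded transform of \<open>\<phi>\<close> integrable, so the
  multiplication formula applies twice: to take the transform off \<open>g\<close>, and then to
  compute the transform of the damped factor.\<close>

lemma fourier_integral_smoothing:
  fixes g \<phi> :: "'a::euclidean_space \<Rightarrow> complex"
  assumes g: "integrable lborel g" and \<phi>: "integrable lborel \<phi>" and \<epsilon>: "\<epsilon> > 0"
  shows "(\<integral>x. fourier_integral 1 g x * fourier_integral (-1) \<phi> x * complex_of_real (gauss (\<epsilon> *\<^sub>R x)) \<partial>lborel)
    = complex_of_real (sqrt (2 * pi) ^ DIM('a)) * (\<integral>\<xi>. g \<xi> * gauss_smoothing \<epsilon> \<phi> \<xi> \<partial>lborel)"
proof -
  have [measurable]: "g \<in> borel_measurable borel" "\<phi> \<in> borel_measurable borel"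
    using g \<phi> by (auto dest: borel_measurable_integrable)
  let ?k = "\<lambda>x::'a. complex_of_real (gauss (\<epsilon> *\<^sub>R x))"
  let ?c = "complex_of_real (sqrt (2 * pi) ^ DIM('a))"
  have k: "integrable lborel ?k"
    using integrable_gauss_scale[of \<epsilon>] \<epsilon> by (simp add: complex_of_real_integrable_eq)
  have Vk: "integrable lborel (\<lambda>x. fourier_integral (-1) \<phi> x * ?k x)"
  proof (rule Bochner_Integration.integrable_bound)
    show "integrable lborel (\<lambda>x. complex_of_real (\<integral>y. norm (\<phi> y) \<partial>lborel) * ?k x)"
      using k by simp
    show "AE x in lborel. norm (fourier_integral (-1) \<phi> x * ?k x)
        \<le> norm (complex_of_real (\<integral>y. norm (\<phi> y) \<partial>lborel) * ?k x)"
      by (auto simp: norm_mult intro!: mult_right_mono norm_fourier_integral_le \<phi>)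
  qed simp
  \<comment> \<open>Modulation by \<open>cis (\<xi> \<bullet> x)\<close> becomes translation of the
    transform, so the transformed Gaussian is centred at \<open>\<xi>\<close> and acts on
    \<open>\<phi>\<close> as a convolution kernel.\<close>
  have inner: "fourier_integral 1 (\<lambda>x. fourier_integral (-1) \<phi> x * ?k x) \<xi>
      = ?c * gauss_smoothing \<epsilon> \<phi> \<xi>" for \<xi>
  proof -
    let ?a = "\<lambda>x. cis (1 * (\<xi> \<bullet> x)) * ?k x"
    have "fourier_integral 1 (\<lambda>x. fourier_integral (-1) \<phi> x * ?k x) \<xi>
        = (\<integral>x. ?a x * fourier_integral (-1) \<phi> x \<partial>lborel)"
      unfolding fourier_integral_def[of 1] by (simp add: ac_simps)
    also have "\<dots> = (\<integral>y. fourier_integral (-1) ?a y * \<phi> y \<partial>lborel)"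
      by (intro fourier_integral_exchange integrable_cis_mult k \<phi>) simp
    also have "(\<lambda>y. fourier_integral (-1) ?a y) = (\<lambda>y. fourier_integral 1 ?k (\<xi> - y))"
      unfolding fourier_integral_def
      by (simp add: mult.assoc[symmetric] cis_mult inner_diff_left)
    also have "(\<integral>y. fourier_integral 1 ?k (\<xi> - y) * \<phi> y \<partial>lborel)
        = (\<integral>y. ?c / complex_of_real \<epsilon> ^ DIM('a) * (gauss ((\<xi> - y) /\<^sub>R \<epsilon>) * \<phi> y) \<partial>lborel)"
      using \<epsilon> by (intro Bochner_Integration.integral_cong refl) (simp add: fourier_integral_gauss_scale)
    also have "\<dots> = ?c / complex_of_real \<epsilon> ^ DIM('a) * (\<integral>y. gauss ((\<xi> - y) /\<^sub>R \<epsilon>) * \<phi> y \<partial>lborel)"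
      by (rule integral_mult_right_zero)
    also have "(\<integral>y. gauss ((\<xi> - y) /\<^sub>R \<epsilon>) * \<phi> y \<partial>lborel)
        = \<bar>\<epsilon>\<bar> ^ DIM('a) *\<^sub>R (\<integral>z. gauss ((\<xi> - (\<xi> + \<epsilon> *\<^sub>R z)) /\<^sub>R \<epsilon>) * \<phi> (\<xi> + \<epsilon> *\<^sub>R z) \<partial>lborel)"
    proof (rule integral_lborel_affine)
      show "integrable lborel (\<lambda>y. gauss ((\<xi> - y) /\<^sub>R \<epsilon>) * \<phi> y)"
        by (rule Bochner_Integration.integrable_bound[OF \<phi>])
          (auto simp: norm_mult gauss_nonneg gauss_le_1 mult_left_le_one_le)
    qed (use \<epsilon> in simp)
    also have "(\<integral>z. gauss ((\<xi> - (\<xi> + \<epsilon> *\<^sub>R z)) /\<^sub>R \<epsilon>) * \<phi> (\<xi> + \<epsilon> *\<^sub>R z) \<partial>lborel) = gauss_smoothing \<epsilon> \<phi> \<xi>"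
      unfolding gauss_smoothing_def using \<epsilon> by (simp add: gauss_minus mult.commute)
    finally show ?thesis
      using \<epsilon> by (simp add: scaleR_conv_of_real)
  qed
  have "(\<integral>x. (fourier_integral (-1) \<phi> x * ?k x) * fourier_integral 1 g x \<partial>lborel)
      = (\<integral>\<xi>. fourier_integral 1 (\<lambda>x. fourier_integral (-1) \<phi> x * ?k x) \<xi> * g \<xi> \<partial>lborel)"
    by (rule fourier_integral_exchange[OF Vk g])
  also have "\<dots> = ?c * (\<integral>\<xi>. g \<xi> * gauss_smoothing \<epsilon> \<phi> \<xi> \<partial>lborel)"
    unfolding inner by (subst integral_mult_right_zero[symmetric]) (simp add: ac_simps)
  finally show ?thesis
    by (simp add: ac_simps)
qed

section \<open>Gaussian smoothing as an approximate identity\<close>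

lemma integral_gauss: "integral\<^sup>L lborel (gauss :: 'a::euclidean_space \<Rightarrow> real) = sqrt (2 * pi) ^ DIM('a)"
  using integral_cis_gauss[of "0::'a"]
  by (simp add: gauss_0 integral_complex_of_real flip: of_real_power of_real_mult)

lemma integrable_bounded_mult_gauss:
  fixes \<phi> :: "'a::euclidean_space \<Rightarrow> complex"
  assumes [measurable]: "\<phi> \<in> borel_measurable borel" and "\<And>x. norm (\<phi> x) \<le> M"
  shows "integrable lborel (\<lambda>z. \<phi> (x + \<epsilon> *\<^sub>R z) * complex_of_real (gauss z))"
  by (rule Bochner_Integration.integrable_bound[of _ "\<lambda>z. M * gauss z"])
    (auto simp: norm_mult gauss_nonneg integrable_gauss
      intro!: AE_I2 order_trans[OF _ abs_ge_self] mult_right_mono assms(2))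

lemma norm_gauss_smoothing_le:
  fixes \<phi> :: "'a::euclidean_space \<Rightarrow> complex"
  assumes "\<phi> \<in> borel_measurable borel" and "\<And>x. norm (\<phi> x) \<le> M"
  shows "norm (gauss_smoothing \<epsilon> \<phi> x) \<le> M * sqrt (2 * pi) ^ DIM('a)"
proof -
  have "norm (gauss_smoothing \<epsilon> \<phi> x) \<le> integral\<^sup>L lborel (\<lambda>z::'a. M * gauss z)"
    unfolding gauss_smoothing_def
    by (rule Bochner_Integration.integral_norm_bound_integral[OF integrable_bounded_mult_gauss[OF assms]])
      (auto simp: integrable_gauss norm_mult gauss_nonneg intro!: mult_right_mono assms)
  then show ?thesis by (simp add: integral_gauss)
qed

lemma gauss_smoothing_measurable [measurable]:
  fixes \<phi> :: "'a::euclidean_space \<Rightarrow> complex"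
  assumes [measurable]: "\<phi> \<in> borel_measurable borel"
  shows "gauss_smoothing \<epsilon> \<phi> \<in> borel_measurable borel"
proof -
  have "(\<lambda>x. gauss_smoothing \<epsilon> \<phi> x) \<in> borel_measurable lborel"
    unfolding gauss_smoothing_def by measurable
  then show ?thesis by simp
qed

lemma gauss_scale_tendsto: "(\<lambda>m. gauss (inverse (real (Suc m)) *\<^sub>R x)) \<longlonglongrightarrow> 1"
proof -
  have "(\<lambda>m. exp (- (inverse (real (Suc m)) * norm x)\<^sup>2 / 2)) \<longlonglongrightarrow> exp (- (0 * norm x)\<^sup>2 / 2)"
    by (intro tendsto_intros LIMSEQ_inverse_real_of_nat) simp
  then show ?thesis by (simp add: gauss_def)
qed

lemma gauss_smoothing_tendsto:
  fixes \<phi> :: "'a::euclidean_space \<Rightarrow> complex"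
  assumes \<phi>: "continuous_on UNIV \<phi>" and M: "\<And>x. norm (\<phi> x) \<le> M"
  shows "(\<lambda>m. gauss_smoothing (inverse (real (Suc m))) \<phi> x)
    \<longlonglongrightarrow> \<phi> x * complex_of_real (sqrt (2 * pi) ^ DIM('a))"
proof -
  have [measurable]: "\<phi> \<in> borel_measurable borel"
    using \<phi> by (rule borel_measurable_continuous_onI)
  have "(\<lambda>m. gauss_smoothing (inverse (real (Suc m))) \<phi> x)
     \<longlonglongrightarrow> (\<integral>z. \<phi> x * complex_of_real (gauss (z::'a)) \<partial>lborel)"
    unfolding gauss_smoothing_def
  proof (rule integral_dominated_convergence[where w="\<lambda>z. M * gauss z"])
    have "(\<lambda>m. \<phi> (x + inverse (real (Suc m)) *\<^sub>R z)) \<longlonglongrightarrow> \<phi> x" for z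
    proof (rule isCont_tendsto_compose[where g=\<phi>])
      show "isCont \<phi> x"
        using \<phi> by (simp add: continuous_on_eq_continuous_at)
      have "(\<lambda>m. x + inverse (real (Suc m)) *\<^sub>R z) \<longlonglongrightarrow> x + 0 *\<^sub>R z"
        by (intro tendsto_intros LIMSEQ_inverse_real_of_nat)
      then show "(\<lambda>m. x + inverse (real (Suc m)) *\<^sub>R z) \<longlonglongrightarrow> x" by simp
    qed
    then show "AE z in lborel. (\<lambda>m. \<phi> (x + inverse (real (Suc m)) *\<^sub>R z) * complex_of_real (gauss z))
        \<longlonglongrightarrow> \<phi> x * complex_of_real (gauss z)"
      by (intro AE_I2 tendsto_intros)
  qed (auto simp: integrable_gauss norm_mult gauss_nonneg intro!: mult_right_mono M)
  then show ?thesis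
    by (simp add: integral_gauss integral_complex_of_real)
qed

lemma sqrt_power_mult_self: "0 \<le> (a::real) \<Longrightarrow> sqrt a ^ d * sqrt a ^ d = a ^ d"
  by (metis power_mult_distrib real_sqrt_mult_self abs_of_nonneg)

text \<open>A substitute for Plancherel's theorem, sufficient for functions of nearly constant modulus:
  the constant involves the product of the supremum and the \<open>L\<^sup>1\<close> norm in place of the squared
  \<open>L\<^sup>2\<close> norm.  Pairing \<open>g\<close> with its own conjugate in the Gaussian-damped identity makes the left
  side \<open>\<bar>Fg\<bar>\<^sup>2\<close> with a damping factor, which is removed by Fatou's lemma.\<close>

lemma fourier_integral_L2_bound:
  fixes g :: "'a::euclidean_space \<Rightarrow> complex"
  assumes g: "integrable lborel g" and M: "\<And>x. norm (g x) \<le> M" and \<sigma>: "\<sigma> = 1 \<or> \<sigma> = -1"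
  shows "(\<integral>\<^sup>+x. ennreal ((norm (fourier_integral \<sigma> g x))\<^sup>2) \<partial>lborel)
    \<le> ennreal ((2 * pi) ^ DIM('a) * M * (\<integral>x. norm (g x) \<partial>lborel))"
proof -
  have *: "(\<integral>\<^sup>+x. ennreal ((norm (fourier_integral 1 g x))\<^sup>2) \<partial>lborel)
    \<le> ennreal ((2 * pi) ^ DIM('a) * M * (\<integral>x. norm (g x) \<partial>lborel))"
    if g: "integrable lborel g" and M: "\<And>x. norm (g x) \<le> M" for g :: "'a \<Rightarrow> complex"
  proof -
    have [measurable]: "g \<in> borel_measurable borel"
      using g by (auto dest: borel_measurable_integrable)
    let ?V = "fourier_integral 1 g"
    let ?c = "sqrt (2 * pi) ^ DIM('a)"
    let ?e = "\<lambda>m. inverse (real (Suc m))"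
    let ?u = "\<lambda>m x. (norm (?V x))\<^sup>2 * gauss (?e m *\<^sub>R x)"
    have gc: "integrable lborel (\<lambda>x. cnj (g x))"
      using g by simp
    have gcm [measurable]: "(\<lambda>x. cnj (g x)) \<in> borel_measurable borel"
      by (rule borel_measurable_integrable[OF gc, simplified])
    have u_int: "integrable lborel (?u m)" for m
    proof (rule Bochner_Integration.integrable_bound)
      show "integrable lborel (\<lambda>x. (\<integral>y. norm (g y) \<partial>lborel)\<^sup>2 * gauss (?e m *\<^sub>R x))"
        by (rule integrable_mult_right, rule integrable_gauss_scale) simp
    qed (auto simp: gauss_nonneg intro!: AE_I2 mult_right_mono power_mono norm_fourier_integral_le g)
    have u_le: "integral\<^sup>L lborel (?u m) \<le> (2 * pi) ^ DIM('a) * M * (\<integral>x. norm (g x) \<partial>lborel)" for m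
    proof -
      have "complex_of_real (integral\<^sup>L lborel (?u m))
        = (\<integral>x. ?V x * fourier_integral (-1) (\<lambda>x. cnj (g x)) x * complex_of_real (gauss (?e m *\<^sub>R x)) \<partial>lborel)"
        by (subst integral_complex_of_real[symmetric])
          (simp add: fourier_integral_cnj[symmetric] complex_norm_square del: of_nat_Suc flip: of_real_power)
      also have "\<dots> = complex_of_real ?c * (\<integral>\<xi>. g \<xi> * gauss_smoothing (?e m) (\<lambda>x. cnj (g x)) \<xi> \<partial>lborel)"
        by (rule fourier_integral_smoothing[OF g gc]) simp
      finally have E: "complex_of_real (integral\<^sup>L lborel (?u m))
          = complex_of_real ?c * (\<integral>\<xi>. g \<xi> * gauss_smoothing (?e m) (\<lambda>x. cnj (g x)) \<xi> \<partial>lborel)" .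
      have "\<bar>integral\<^sup>L lborel (?u m)\<bar> = norm (complex_of_real (integral\<^sup>L lborel (?u m)))"
        by (simp only: norm_of_real)
      also have "\<dots> = ?c * norm (\<integral>\<xi>. g \<xi> * gauss_smoothing (?e m) (\<lambda>x. cnj (g x)) \<xi> \<partial>lborel)"
        unfolding E norm_mult norm_of_real by simp
      \<comment> \<open>Since \<open>g\<close> may be discontinuous, its smoothing is estimated only
        by its supremum, uniformly in \<open>m\<close>; this produces \<open>M\<close> times the
        \<open>L1\<close> norm.\<close>
      also have "\<dots> \<le> ?c * (\<integral>\<xi>. norm (g \<xi>) * (M * ?c) \<partial>lborel)"
      proof (intro mult_left_mono Bochner_Integration.integral_norm_bound_integral)
        have b: "norm (g \<xi> * gauss_smoothing (?e m) (\<lambda>x. cnj (g x)) \<xi>) \<le> norm (g \<xi>) * (M * ?c)" for \<xi>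
          unfolding norm_mult by (intro mult_left_mono norm_gauss_smoothing_le gcm) (auto simp: M)
        then show "norm (g \<xi> * gauss_smoothing (?e m) (\<lambda>x. cnj (g x)) \<xi>) \<le> norm (g \<xi>) * (M * ?c)" for \<xi> .
        show I: "integrable lborel (\<lambda>\<xi>. norm (g \<xi>) * (M * ?c))"
          using g by simp
        show "integrable lborel (\<lambda>\<xi>. g \<xi> * gauss_smoothing (?e m) (\<lambda>x. cnj (g x)) \<xi>)"
        proof (rule Bochner_Integration.integrable_bound[OF I])
          show "AE \<xi> in lborel. norm (g \<xi> * gauss_smoothing (?e m) (\<lambda>x. cnj (g x)) \<xi>)
              \<le> norm (norm (g \<xi>) * (M * ?c))"
            unfolding real_norm_def by (intro AE_I2 order_trans[OF b abs_ge_self])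
        qed measurable
      qed simp
      also have "\<dots> = (?c * ?c) * M * (\<integral>x. norm (g x) \<partial>lborel)"
        by simp
      also have "?c * ?c = (2 * pi) ^ DIM('a)"
        by (rule sqrt_power_mult_self) simp
      finally show ?thesis by simp
    qed
    have "(\<integral>\<^sup>+x. ennreal ((norm (?V x))\<^sup>2) \<partial>lborel) = (\<integral>\<^sup>+x. liminf (\<lambda>m. ennreal (?u m x)) \<partial>lborel)"
    proof (intro nn_integral_cong)
      fix x
      have "(\<lambda>m. ?u m x) \<longlonglongrightarrow> (norm (?V x))\<^sup>2 * 1"
        by (intro tendsto_intros gauss_scale_tendsto)
      then have "(\<lambda>m. ennreal (?u m x)) \<longlonglongrightarrow> ennreal ((norm (?V x))\<^sup>2)"
        by (intro tendsto_ennrealI) simp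
      then show "ennreal ((norm (?V x))\<^sup>2) = liminf (\<lambda>m. ennreal (?u m x))"
        by (rule lim_imp_Liminf[symmetric, rotated]) simp
    qed
    also have "\<dots> \<le> liminf (\<lambda>m. \<integral>\<^sup>+x. ennreal (?u m x) \<partial>lborel)"
      by (rule nn_integral_liminf) simp
    also have "\<dots> \<le> ennreal ((2 * pi) ^ DIM('a) * M * (\<integral>x. norm (g x) \<partial>lborel))"
    proof (rule Liminf_le)
      show "\<forall>\<^sub>F m in sequentially. (\<integral>\<^sup>+x. ennreal (?u m x) \<partial>lborel)
          \<le> ennreal ((2 * pi) ^ DIM('a) * M * (\<integral>x. norm (g x) \<partial>lborel))"
      proof (intro always_eventually allI)
        fix m
        have "(\<integral>\<^sup>+x. ennreal (?u m x) \<partial>lborel) = ennreal (integral\<^sup>L lborel (?u m))"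
          by (rule nn_integral_eq_integral[OF u_int]) (simp add: gauss_nonneg)
        then show "(\<integral>\<^sup>+x. ennreal (?u m x) \<partial>lborel)
          \<le> ennreal ((2 * pi) ^ DIM('a) * M * (\<integral>x. norm (g x) \<partial>lborel))"
          by (simp only: ennreal_leI[OF u_le])
      qed
    qed simp
    finally show ?thesis .
  qed
  show ?thesis
  proof (cases "\<sigma> = 1")
    case True
    then show ?thesis using *[OF g M] by simp
  next
    case False
    then have "\<sigma> = -1" using \<sigma> by simp
    then have "norm (fourier_integral \<sigma> g x) = norm (fourier_integral 1 (\<lambda>y. cnj (g y)) x)" for x
      by (metis complex_mod_cnj fourier_integral_cnj minus_minus)
    then show ?thesis
      using *[of "\<lambda>y. cnj (g y)"] g M by simp
  qed
qed

text \<open>Pairing both transforms avoids Fourier inversion: the transforms are square integrable but need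
  not be integrable.\<close>

lemma fourier_integral_parseval:
  fixes g \<phi> :: "'a::euclidean_space \<Rightarrow> complex"
  assumes g: "integrable lborel g" and gM: "\<And>x. norm (g x) \<le> M"
    and \<phi>: "integrable lborel \<phi>" and \<phi>B: "\<And>x. norm (\<phi> x) \<le> B" and \<phi>c: "continuous_on UNIV \<phi>"
  shows "(\<integral>x. fourier_integral 1 g x * fourier_integral (-1) \<phi> x \<partial>lborel)
    = complex_of_real ((2 * pi) ^ DIM('a)) * (\<integral>\<xi>. g \<xi> * \<phi> \<xi> \<partial>lborel)"
proof -
  have [measurable]: "g \<in> borel_measurable borel" "\<phi> \<in> borel_measurable borel"
    using g \<phi> by (auto dest: borel_measurable_integrable)
  let ?V = "fourier_integral 1 g" and ?\<Phi> = "fourier_integral (-1) \<phi>"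
  let ?c = "sqrt (2 * pi) ^ DIM('a)"
  let ?e = "\<lambda>m. inverse (real (Suc m))"
  have sq: "integrable lborel (\<lambda>x. (norm (fourier_integral \<sigma> h x))\<^sup>2)"
    if h: "integrable lborel h" "\<And>x. norm (h x) \<le> K" "\<sigma> = 1 \<or> \<sigma> = -1" for h :: "'a \<Rightarrow> complex" and K \<sigma>
  proof -
    have [measurable]: "h \<in> borel_measurable borel"
      using h by (auto dest: borel_measurable_integrable)
    show ?thesis
      using fourier_integral_L2_bound[OF h]
      by (intro integrableI_bounded) (auto intro: le_less_trans)
  qed
  \<comment> \<open>A majorant of the product that is integrable by the \<open>L2\<close> bounds,
    and serves for all damping parameters at once.\<close>
  let ?w = "\<lambda>x. (norm (?V x))\<^sup>2 + (norm (?\<Phi> x))\<^sup>2"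
  have w: "integrable lborel ?w"
    using sq[OF g gM] sq[OF \<phi> \<phi>B] by auto
  have VP: "norm (?V x * ?\<Phi> x) \<le> ?w x" for x
  proof -
    have "0 \<le> (norm (?V x) - norm (?\<Phi> x))\<^sup>2" by simp
    moreover have "0 \<le> norm (?V x) * norm (?\<Phi> x)" by simp
    ultimately show ?thesis unfolding norm_mult power2_diff by linarith
  qed
  have l: "(\<lambda>m. \<integral>x. ?V x * ?\<Phi> x * complex_of_real (gauss (?e m *\<^sub>R x)) \<partial>lborel)
      \<longlonglongrightarrow> (\<integral>x. ?V x * ?\<Phi> x \<partial>lborel)"
  proof (rule integral_dominated_convergence[OF _ _ w])
    show "AE x in lborel. (\<lambda>m. ?V x * ?\<Phi> x * complex_of_real (gauss (?e m *\<^sub>R x))) \<longlonglongrightarrow> ?V x * ?\<Phi> x"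
    proof (rule AE_I2)
      fix x
      have "(\<lambda>m. ?V x * ?\<Phi> x * complex_of_real (gauss (?e m *\<^sub>R x))) \<longlonglongrightarrow> ?V x * ?\<Phi> x * complex_of_real 1"
        by (intro tendsto_intros gauss_scale_tendsto)
      then show "(\<lambda>m. ?V x * ?\<Phi> x * complex_of_real (gauss (?e m *\<^sub>R x))) \<longlonglongrightarrow> ?V x * ?\<Phi> x"
        by simp
    qed
    show "AE x in lborel. norm (?V x * ?\<Phi> x * complex_of_real (gauss (?e m *\<^sub>R x))) \<le> ?w x" for m
    proof (rule AE_I2)
      fix x
      have "norm (?V x * ?\<Phi> x * complex_of_real (gauss (?e m *\<^sub>R x))) \<le> norm (?V x * ?\<Phi> x) * 1"
        unfolding norm_mult[of "?V x * ?\<Phi> x"]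
        by (intro mult_left_mono) (auto simp: gauss_nonneg gauss_le_1)
      then show "norm (?V x * ?\<Phi> x * complex_of_real (gauss (?e m *\<^sub>R x))) \<le> ?w x"
        using VP[of x] by simp
    qed
  qed measurable
  have r: "(\<lambda>m. \<integral>\<xi>. g \<xi> * gauss_smoothing (?e m) \<phi> \<xi> \<partial>lborel)
      \<longlonglongrightarrow> (\<integral>\<xi>. g \<xi> * (\<phi> \<xi> * complex_of_real ?c) \<partial>lborel)"
  proof (rule integral_dominated_convergence[where w="\<lambda>\<xi>. norm (g \<xi>) * (B * ?c)"])
    show "AE \<xi> in lborel. (\<lambda>m. g \<xi> * gauss_smoothing (?e m) \<phi> \<xi>) \<longlonglongrightarrow> g \<xi> * (\<phi> \<xi> * complex_of_real ?c)"
      by (intro AE_I2 tendsto_intros gauss_smoothing_tendsto[OF \<phi>c \<phi>B])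
    show "AE \<xi> in lborel. norm (g \<xi> * gauss_smoothing (?e m) \<phi> \<xi>) \<le> norm (g \<xi>) * (B * ?c)" for m
      unfolding norm_mult by (intro AE_I2 mult_left_mono norm_gauss_smoothing_le \<phi>B) auto
  qed (use g in auto)
  \<comment> \<open>The damped identity holds for every \<open>m\<close>, so the limits of its two
    sides agree. One \<open>?c\<close> belongs to that identity, the other is the mass of the
    Gaussian in the limit of the smoothing.\<close>
  have "(\<integral>x. ?V x * ?\<Phi> x \<partial>lborel) = complex_of_real ?c * (\<integral>\<xi>. g \<xi> * (\<phi> \<xi> * complex_of_real ?c) \<partial>lborel)"
  proof (rule LIMSEQ_unique[OF l])
    have "(\<integral>x. ?V x * ?\<Phi> x * complex_of_real (gauss (?e m *\<^sub>R x)) \<partial>lborel)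
        = complex_of_real ?c * (\<integral>\<xi>. g \<xi> * gauss_smoothing (?e m) \<phi> \<xi> \<partial>lborel)" for m
      by (rule fourier_integral_smoothing[OF g \<phi>]) simp
    then show "(\<lambda>m. \<integral>x. ?V x * ?\<Phi> x * complex_of_real (gauss (?e m *\<^sub>R x)) \<partial>lborel)
        \<longlonglongrightarrow> complex_of_real ?c * (\<integral>\<xi>. g \<xi> * (\<phi> \<xi> * complex_of_real ?c) \<partial>lborel)"
      by (simp only:) (intro tendsto_mult tendsto_const r)
  qed
  also have "\<dots> = complex_of_real (?c * ?c) * (\<integral>\<xi>. g \<xi> * \<phi> \<xi> \<partial>lborel)"
    by (simp flip: mult.assoc)
  also have "?c * ?c = (2 * pi) ^ DIM('a)"
    by (rule sqrt_power_mult_self) simp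
  finally show ?thesis .
qed

section \<open>Distributions and multipliers\<close>

lemma
  fixes f :: "'a::euclidean_space \<Rightarrow> 'b::{banach, second_countable_topology}"
  assumes "f \<in> borel_measurable borel"
  shows integrable_lebesgue_borel: "integrable lebesgue f \<longleftrightarrow> integrable lborel f"
    and integral_lebesgue_borel: "integral\<^sup>L lebesgue f = integral\<^sup>L lborel f"
  using assms by (simp_all add: integrable_completion integral_completion)

lemma borel_measurable_lebesgue: "f \<in> borel_measurable borel \<Longrightarrow> f \<in> borel_measurable lebesgue"
  by (simp add: measurable_completion)

section \<open>Test functions, and transforms as distributions\<close>

lemma smooth_continuous: "smooth \<phi> \<Longrightarrow> continuous_on UNIV \<phi>"
  unfolding smooth_def by (metis iterated_partial.simps(1) differentiable_imp_continuous_on)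

lemma smooth_borel: "smooth \<phi> \<Longrightarrow> \<phi> \<in> borel_measurable borel"
  by (intro borel_measurable_continuous_onI smooth_continuous)

lemma
  assumes "\<phi> \<in> test_functions"
  shows test_function_integrable: "integrable lborel \<phi>"
    and test_function_bounded: "\<exists>B. \<forall>x. norm (\<phi> x) \<le> B"
    and test_function_continuous: "continuous_on UNIV \<phi>"
proof -
  let ?K = "closure {x. \<phi> x \<noteq> 0}"
  have s: "smooth \<phi>" and K: "compact ?K"
    using assms by (auto simp: test_functions_def)
  show c: "continuous_on UNIV \<phi>"
    using s by (rule smooth_continuous)
  have sub: "\<phi> x \<noteq> 0 \<Longrightarrow> x \<in> ?K" for x
    using closure_subset[of "{x. \<phi> x \<noteq> 0}"] by auto
  have "bounded (\<phi> ` ?K)"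
    by (intro compact_imp_bounded compact_continuous_image continuous_on_subset[OF c] K) simp
  then obtain B where B: "\<And>x. x \<in> ?K \<Longrightarrow> norm (\<phi> x) \<le> B" and "0 < B"
    unfolding bounded_pos by auto
  then show "\<exists>B. \<forall>x. norm (\<phi> x) \<le> B"
    by (metis sub norm_zero less_imp_le)
  have "(\<lambda>x. indicator ?K x *\<^sub>R \<phi> x) = \<phi>"
    using sub by (auto simp: indicator_def fun_eq_iff)
  moreover have "integrable lborel (\<lambda>x. indicator ?K x *\<^sub>R \<phi> x)"
    using borel_integrable_compact[OF K continuous_on_subset[OF c]] by simp
  ultimately show "integrable lborel \<phi>" by simp
qed

lemma
  assumes [measurable]: "(g :: real^'n \<Rightarrow> complex) \<in> borel_measurable borel"
  shows fourier_eq: "fourier g = fourier_integral (-1) g"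
    and inv_fourier_eq: "inv_fourier g = (\<lambda>x. complex_of_real (1 / (2 * pi) ^ CARD('n)) * fourier_integral 1 g x)"
  unfolding fourier_def inv_fourier_def fourier_integral_def fun_eq_iff
  by (simp_all add: integral_lebesgue_borel inner_commute)

lemma inv_fourier_measurable [measurable]:
  assumes [measurable]: "g \<in> borel_measurable borel"
  shows "inv_fourier g \<in> borel_measurable borel"
  by (simp add: inv_fourier_eq)

lemma norm_inv_fourier_le:
  fixes g :: "real^'n \<Rightarrow> complex"
  assumes g: "integrable lborel g"
  shows "norm (inv_fourier g x) \<le> (\<integral>y. norm (g y) \<partial>lborel) / (2 * pi) ^ CARD('n)"
proof -
  have "g \<in> borel_measurable borel"
    using g by (auto dest: borel_measurable_integrable)
  then show ?thesis
    using norm_fourier_integral_le[OF g, of 1 x]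
    by (simp add: inv_fourier_eq norm_mult norm_divide norm_power divide_right_mono)
qed

lemma integrable_bounded_mult:
  fixes a b :: "'a::euclidean_space \<Rightarrow> complex"
  assumes a: "integrable lborel a" and [measurable]: "b \<in> borel_measurable borel"
    and b: "\<And>x. norm (b x) \<le> B"
  shows "integrable lborel (\<lambda>x. b x * a x)"
proof (rule Bochner_Integration.integrable_bound)
  show "integrable lborel (\<lambda>x. complex_of_real B * a x)"
    using a by simp
  show "(\<lambda>x. b x * a x) \<in> borel_measurable lborel"
    using borel_measurable_integrable[OF a] by simp
  show "AE x in lborel. norm (b x * a x) \<le> norm (complex_of_real B * a x)"
    unfolding norm_mult norm_of_real
    by (intro AE_I2 mult_right_mono order_trans[OF b abs_ge_self]) simp
qed

text \<open>For integrable \<open>G\<close> the distributional inverse transform is the pointwise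
  one, by the multiplication formula. All pairings are integrable because each multiplies an
  integrable function by a bounded one.\<close>

lemma inv_fourier_represented_by_inv_fourier:
  fixes G :: "real^'n \<Rightarrow> complex"
  assumes G: "integrable lborel G"
  shows "inv_fourier_represented_by G (inv_fourier G)"
proof -
  have [measurable]: "G \<in> borel_measurable borel"
    using G by (auto dest: borel_measurable_integrable)
  have "integrable lebesgue (\<lambda>\<xi>. G \<xi> * inv_fourier \<phi> \<xi>) \<and>
      integrable lebesgue (\<lambda>x. inv_fourier G x * \<phi> x) \<and>
      (LINT \<xi>|lebesgue. G \<xi> * inv_fourier \<phi> \<xi>) = (LINT x|lebesgue. inv_fourier G x * \<phi> x)"
    if "\<phi> \<in> test_functions" for \<phi>
  proof -
    note \<phi> = test_function_integrable[OF that]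
    have [measurable]: "\<phi> \<in> borel_measurable borel"
      using \<phi> by (auto dest: borel_measurable_integrable)
    have 1: "integrable lborel (\<lambda>\<xi>. G \<xi> * inv_fourier \<phi> \<xi>)"
      using integrable_bounded_mult[OF G _ norm_inv_fourier_le[OF \<phi>]] by (simp add: mult.commute)
    have 2: "integrable lborel (\<lambda>x. inv_fourier G x * \<phi> x)"
      using integrable_bounded_mult[OF \<phi> _ norm_inv_fourier_le[OF G]] by simp
    have "(\<integral>x. G x * fourier_integral 1 \<phi> x \<partial>lborel) = (\<integral>y. fourier_integral 1 G y * \<phi> y \<partial>lborel)"
      by (rule fourier_integral_exchange[OF G \<phi>])
    then have "complex_of_real (1 / (2 * pi) ^ CARD('n)) * (\<integral>x. G x * fourier_integral 1 \<phi> x \<partial>lborel)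
      = complex_of_real (1 / (2 * pi) ^ CARD('n)) * (\<integral>y. fourier_integral 1 G y * \<phi> y \<partial>lborel)"
      by (simp only:)
    then have "(\<integral>\<xi>. G \<xi> * inv_fourier \<phi> \<xi> \<partial>lborel) = (\<integral>x. inv_fourier G x * \<phi> x \<partial>lborel)"
      unfolding integral_mult_right_zero[symmetric] by (simp add: inv_fourier_eq mult.left_commute mult.assoc)
    with 1 2 show ?thesis
      by (simp add: integrable_lebesgue_borel integral_lebesgue_borel)
  qed
  then show ?thesis
    unfolding inv_fourier_represented_by_def represented_by_def
    by (auto intro: borel_measurable_lebesgue)
qed

text \<open>Where the product is not integrable the Bochner integral gives the default 0. For
  integrable \<open>g\<close> this does not happen on Schwartz functions, as
  \<open>inv_fourier g\<close> is then bounded.\<close>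

definition inv_fourier_distribution :: "(real^'n \<Rightarrow> complex) \<Rightarrow> (real^'n \<Rightarrow> complex) \<Rightarrow> complex" where
  "inv_fourier_distribution g \<psi> = (LINT x|lebesgue. inv_fourier g x * \<psi> x)"

text \<open>Evaluating the distribution at \<open>fourier \<phi>\<close> pairs two transforms of
  opposite sign, which is the left side of Parseval's identity; its factor
  \<open>(2 * pi) ^ n\<close> cancels the normalisation of \<open>inv_fourier\<close>.\<close>

lemma dist_fourier_inv_fourier_distribution:
  fixes g :: "real^'n \<Rightarrow> complex"
  assumes g: "integrable lborel g" and M: "\<And>x. norm (g x) \<le> M"
  shows "represented_by (dist_fourier (inv_fourier_distribution g)) g"
proof -
  have [measurable]: "g \<in> borel_measurable borel"
    using g by (auto dest: borel_measurable_integrable)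
  have "integrable lebesgue (\<lambda>x. g x * \<phi> x) \<and>
      dist_fourier (inv_fourier_distribution g) \<phi> = (LINT x|lebesgue. g x * \<phi> x)"
    if t: "\<phi> \<in> test_functions" for \<phi>
  proof -
    note \<phi> = test_function_integrable[OF t]
    have [measurable]: "\<phi> \<in> borel_measurable borel"
      using \<phi> by (auto dest: borel_measurable_integrable)
    obtain B where B: "\<And>x. norm (\<phi> x) \<le> B"
      using test_function_bounded[OF t] by auto
    have "integrable lborel (\<lambda>x. g x * \<phi> x)"
      using integrable_bounded_mult[OF \<phi> _ M] by simp
    moreover have "(\<integral>x. inv_fourier g x * fourier \<phi> x \<partial>lborel) = (\<integral>x. g x * \<phi> x \<partial>lborel)"
      using fourier_integral_parseval[OF g M \<phi> B test_function_continuous[OF t]]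
      by (simp add: inv_fourier_eq fourier_eq mult.assoc)
    moreover have "fourier \<phi> \<in> borel_measurable borel"
      by (simp add: fourier_eq)
    ultimately show ?thesis
      unfolding dist_fourier_def inv_fourier_distribution_def
      by (simp add: integrable_lebesgue_borel integral_lebesgue_borel)
  qed
  then show ?thesis
    unfolding represented_by_def by (auto intro: borel_measurable_lebesgue)
qed

lemma fourier_multiplier_inv_fourier_distribution:
  fixes g m :: "real^'n \<Rightarrow> complex"
  assumes g: "integrable lborel g" "\<And>x. norm (g x) \<le> M" and mg: "integrable lborel (\<lambda>\<xi>. m \<xi> * g \<xi>)"
  shows "fourier_multiplier m (inv_fourier_distribution g) (inv_fourier (\<lambda>\<xi>. m \<xi> * g \<xi>))"
  unfolding fourier_multiplier_def
  using dist_fourier_inv_fourier_distribution[OF g] inv_fourier_represented_by_inv_fourier[OF mg] by blast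

section \<open>Integrability of Schwartz functions and temperedness\<close>

lemma integrable_inverse_one_plus_square: "integrable lborel (\<lambda>x::real. inverse (1 + x\<^sup>2))"
  using integrable_inverse_1_plus_square by (simp add: set_integrable_def)

text \<open>Each of the \<open>DIM('a)\<close> factors \<open>(1 + norm x)^2\<close> dominates one
  factor \<open>1 + (x \<bullet> b)^2\<close>, so a product of one-dimensional integrable functions
  is a majorant.\<close>

lemma integrable_norm_power: "integrable lborel (\<lambda>x::'a::euclidean_space. inverse ((1 + norm x) ^ (2 * DIM('a))))"
proof (rule Bochner_Integration.integrable_bound)
  show "integrable lborel (\<lambda>x::'a. \<Prod>b\<in>Basis. inverse (1 + (x \<bullet> b)\<^sup>2))"
    by (intro integrable_lborel_prod integrable_inverse_one_plus_square)
  have "inverse ((1 + norm x) ^ (2 * DIM('a))) \<le> (\<Prod>b\<in>Basis. inverse (1 + (x \<bullet> b)\<^sup>2))" for x :: 'a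
  proof -
    have "inverse ((1 + norm x) ^ (2 * DIM('a))) = (\<Prod>b\<in>(Basis::'a set). inverse ((1 + norm x)\<^sup>2))"
      by (simp add: power_mult power_inverse)
    also have "\<dots> \<le> (\<Prod>b\<in>Basis. inverse (1 + (x \<bullet> b)\<^sup>2))"
    proof (intro prod_mono conjI le_imp_inverse_le)
      fix b :: 'a assume b: "b \<in> Basis"
      have "(x \<bullet> b)\<^sup>2 \<le> (norm x)\<^sup>2"
        using Basis_le_norm[OF b, of x] by (simp add: abs_le_square_iff[symmetric])
      then show "1 + (x \<bullet> b)\<^sup>2 \<le> (1 + norm x)\<^sup>2"
        using norm_ge_zero[of x] by (simp add: power2_sum del: norm_ge_zero)
      show "0 < 1 + (x \<bullet> b)\<^sup>2" by (simp add: add_pos_nonneg)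
    qed auto
    finally show ?thesis .
  qed
  then show "AE x in lborel. norm (inverse ((1 + norm x) ^ (2 * DIM('a))))
      \<le> norm (\<Prod>b\<in>Basis. inverse (1 + ((x::'a) \<bullet> b)\<^sup>2))"
    by (intro AE_I2) (smt (verit, best) norm_ge_zero real_norm_def zero_le_power inverse_nonnegative_iff_nonnegative)
qed simp

text \<open>A real supremum dominates its members only if the family is bounded above. It is,
  because there are finitely many lists of at most \<open>N\<close> indices and each single
  derivative has a bound; the empty list then gives \<open>\<phi>\<close> itself.\<close>

lemma schwartz_seminorm_bound:
  fixes \<phi> :: "real^'n \<Rightarrow> complex"
  assumes "\<phi> \<in> schwartz_functions"
  shows "(1 + norm x) ^ N * norm (\<phi> x) \<le> schwartz_seminorm N \<phi>"
proof -
  let ?h = "\<lambda>(js, x). (1 + norm x) ^ N * cmod (iterated_partial js \<phi> x)"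
  have "finite {js :: 'n list. length js \<le> N}"
    using finite_lists_length_le[of "UNIV :: 'n set" N] by simp
  moreover have "bdd_above (range (\<lambda>x. (1 + norm x) ^ N * cmod (iterated_partial js \<phi> x)))" for js
    using assms unfolding schwartz_functions_def by (auto intro: bounded_imp_bdd_above)
  ultimately have "bdd_above (\<Union>js\<in>{js. length js \<le> N}. range (\<lambda>x. (1 + norm x) ^ N * cmod (iterated_partial js \<phi> x)))"
    by (simp add: bdd_above_UN)
  moreover have "?h ` ({js. length js \<le> N} \<times> UNIV)
      = (\<Union>js\<in>{js. length js \<le> N}. range (\<lambda>x. (1 + norm x) ^ N * cmod (iterated_partial js \<phi> x)))"
    by auto
  ultimately have "bdd_above (?h ` ({js. length js \<le> N} \<times> UNIV))" by simp
  from cSUP_upper[OF _ this, of "([], x)"] show ?thesis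
    unfolding schwartz_seminorm_def by simp
qed

lemma
  fixes \<phi> :: "real^'n \<Rightarrow> complex"
  assumes \<phi>: "\<phi> \<in> schwartz_functions"
  shows schwartz_integrable: "integrable lborel \<phi>"
    and schwartz_integral_le: "(\<integral>x. norm (\<phi> x) \<partial>lborel)
      \<le> (\<integral>x. inverse ((1 + norm (x :: real^'n)) ^ (2 * CARD('n))) \<partial>lborel) * schwartz_seminorm (2 * CARD('n)) \<phi>"
proof -
  let ?N = "2 * CARD('n)"
  let ?w = "\<lambda>x :: real^'n. inverse ((1 + norm x) ^ ?N)"
  have [measurable]: "\<phi> \<in> borel_measurable borel"
    using \<phi> by (auto simp: schwartz_functions_def intro: smooth_borel)
  have w: "integrable lborel (\<lambda>x. ?w x * schwartz_seminorm ?N \<phi>)"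
    using integrable_norm_power[where 'a="real^'n"] by simp
  have le: "norm (\<phi> x) \<le> ?w x * schwartz_seminorm ?N \<phi>" for x
  proof -
    have "0 < (1 + norm x) ^ ?N"
      by (simp add: add_pos_nonneg)
    then show ?thesis
      using schwartz_seminorm_bound[OF \<phi>, of x ?N] by (simp add: field_simps)
  qed
  show i: "integrable lborel \<phi>"
    by (rule Bochner_Integration.integrable_bound[OF w]) (use le in \<open>auto intro!: AE_I2 order_trans[OF le abs_ge_self]\<close>)
  have "(\<integral>x. norm (\<phi> x) \<partial>lborel) \<le> (\<integral>x. ?w x * schwartz_seminorm ?N \<phi> \<partial>lborel)"
    by (intro integral_mono w le) (use i in simp)
  then show "(\<integral>x. norm (\<phi> x) \<partial>lborel) \<le> integral\<^sup>L lborel ?w * schwartz_seminorm ?N \<phi>"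
    by simp
qed

text \<open>The continuity constant is the bound on \<open>inv_fourier g\<close> times the integral
  of the inverse weight; the order \<open>2 * CARD('n)\<close> of the seminorm is the one for which
  that weight was shown to be integrable.\<close>

lemma tempered_inv_fourier_distribution:
  fixes g :: "real^'n \<Rightarrow> complex"
  assumes g: "integrable lborel g"
  shows "tempered_distribution (inv_fourier_distribution g)"
proof -
  have [measurable]: "g \<in> borel_measurable borel"
    using g by (auto dest: borel_measurable_integrable)
  let ?B = "(\<integral>y. norm (g y) \<partial>lborel) / (2 * pi) ^ CARD('n)"
  let ?w = "\<integral>x. inverse ((1 + norm (x :: real^'n)) ^ (2 * CARD('n))) \<partial>lborel"
  have meas: "\<phi> \<in> borel_measurable borel" if "\<phi> \<in> schwartz_functions" for \<phi> :: "real^'n \<Rightarrow> complex"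
    using that by (auto simp: schwartz_functions_def intro: smooth_borel)
  have eq: "inv_fourier_distribution g \<phi> = (\<integral>x. inv_fourier g x * \<phi> x \<partial>lborel)"
    if [measurable]: "\<phi> \<in> borel_measurable borel" for \<phi>
    unfolding inv_fourier_distribution_def by (rule integral_lebesgue_borel) measurable
  have int: "integrable lborel (\<lambda>x. inv_fourier g x * \<phi> x)" if "\<phi> \<in> schwartz_functions" for \<phi>
    by (rule integrable_bounded_mult[OF schwartz_integrable[OF that] _ norm_inv_fourier_le[OF g]]) simp
  have "inv_fourier_distribution g (\<lambda>x. \<phi> x + \<psi> x) = inv_fourier_distribution g \<phi> + inv_fourier_distribution g \<psi>"
    if "\<phi> \<in> schwartz_functions" "\<psi> \<in> schwartz_functions" for \<phi> \<psi>
  proof -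
    note [measurable] = meas[OF that(1)] meas[OF that(2)]
    show ?thesis
      by (subst (1 2 3) eq) (simp_all add: int that distrib_left)
  qed
  moreover have "inv_fourier_distribution g (\<lambda>x. c * \<phi> x) = c * inv_fourier_distribution g \<phi>"
    if "\<phi> \<in> schwartz_functions" for c \<phi>
  proof -
    note [measurable] = meas[OF that]
    show ?thesis
      by (subst (1 2) eq) (simp_all add: mult.left_commute[of _ c])
  qed
  moreover have "norm (inv_fourier_distribution g \<phi>) \<le> (?B * ?w) * schwartz_seminorm (2 * CARD('n)) \<phi>"
    if \<phi>: "\<phi> \<in> schwartz_functions" for \<phi>
  proof -
    have "norm (inv_fourier_distribution g \<phi>) \<le> (\<integral>x. ?B * norm (\<phi> x) \<partial>lborel)"
      unfolding eq[OF meas[OF \<phi>]]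
    proof (rule Bochner_Integration.integral_norm_bound_integral[OF int[OF \<phi>]])
      show "integrable lborel (\<lambda>x. ?B * norm (\<phi> x))"
        using schwartz_integrable[OF \<phi>] by simp
      show "norm (inv_fourier g x * \<phi> x) \<le> ?B * norm (\<phi> x)" for x
        unfolding norm_mult by (intro mult_right_mono norm_inv_fourier_le g) simp
    qed
    also have "\<dots> = ?B * (\<integral>x. norm (\<phi> x) \<partial>lborel)"
      by (rule integral_mult_right_zero)
    also have "\<dots> \<le> ?B * (?w * schwartz_seminorm (2 * CARD('n)) \<phi>)"
      by (intro mult_left_mono schwartz_integral_le \<phi>) simp
    finally show ?thesis by (simp only: mult.assoc)
  qed
  ultimately show ?thesis
    unfolding tempered_distribution_def by blast
qed

section \<open>Upper bound for the Sobolev norm\<close>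

lemma ennreal_powr_ennreal: "0 \<le> a \<Longrightarrow> ennreal_powr (ennreal a) q = ennreal (a powr q)"
  by (simp add: ennreal_powr_def)

lemma ennreal_powr_mono: "a \<le> b \<Longrightarrow> 0 \<le> q \<Longrightarrow> ennreal_powr a q \<le> ennreal_powr b q"
  by (auto simp: ennreal_powr_def top_unique less_top intro!: ennreal_leI powr_mono2 enn2real_mono)

text \<open>An infimum is bounded by any admissible representative, here the inverse transform of
  \<open>norm \<xi> powr s * g \<xi>\<close>. Squaring its normalisation gives
  \<open>(2 * pi) ^ (- 2 n)\<close>, of which the \<open>L2\<close> bound takes back
  \<open>(2 * pi) ^ n\<close>.\<close>

lemma sobolev_norm_inv_fourier_distribution_le:
  fixes g :: "real^'n \<Rightarrow> complex"
  assumes g: "integrable lborel g" and M: "\<And>x. norm (g x) \<le> M"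
    and h: "integrable lborel (\<lambda>\<xi>. norm \<xi> powr s * norm (g \<xi>))"
    and L: "\<And>\<xi>. norm \<xi> powr s * norm (g \<xi>) \<le> L"
  shows "sobolev_norm s (inv_fourier_distribution g)
    \<le> ennreal ((L * (\<integral>\<xi>. norm \<xi> powr s * norm (g \<xi>) \<partial>lborel) / (2 * pi) ^ CARD('n)) powr (1/2))"
proof -
  have [measurable]: "g \<in> borel_measurable borel"
    using g by (auto dest: borel_measurable_integrable)
  let ?h = "\<lambda>\<xi>. complex_of_real (norm \<xi> powr s) * g \<xi>"
  let ?I = "\<integral>\<xi>. norm \<xi> powr s * norm (g \<xi>) \<partial>lborel"
  let ?d = "(2 * pi) ^ CARD('n)"
  have hi: "integrable lborel ?h"
    by (rule Bochner_Integration.integrable_bound[OF h]) (auto simp: norm_mult)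
  have hm [measurable]: "?h \<in> borel_measurable borel"
    by measurable
  have "0 \<le> L"
    using L[of 0] by (meson norm_ge_zero mult_nonneg_nonneg powr_ge_zero order_trans)
  then have nn: "0 \<le> L * ?I"
    by simp
  have "laplacian_half_power s (inv_fourier_distribution g) (inv_fourier ?h)"
    unfolding laplacian_half_power_def by (rule fourier_multiplier_inv_fourier_distribution[OF g M hi])
  then have "sobolev_norm s (inv_fourier_distribution g) \<le> L2_norm lebesgue (inv_fourier ?h)"
    unfolding sobolev_norm_def by (intro INF_lower) simp
  also have "\<dots> \<le> ennreal_powr (ennreal (L * ?I / ?d)) (1/2)"
    unfolding L2_norm_def
  proof (rule ennreal_powr_mono)
    have "(\<integral>\<^sup>+x. ennreal ((norm (inv_fourier ?h x))\<^sup>2) \<partial>lebesgue)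
      = (\<integral>\<^sup>+x. ennreal (1 / ?d\<^sup>2) * ennreal ((norm (fourier_integral 1 ?h x))\<^sup>2) \<partial>lborel)"
      unfolding nn_integral_completion inv_fourier_eq[OF hm]
      by (intro nn_integral_cong)
        (subst ennreal_mult[symmetric], simp_all add: norm_mult norm_divide norm_power power_divide)
    also have "\<dots> = ennreal (1 / ?d\<^sup>2) * (\<integral>\<^sup>+x. ennreal ((norm (fourier_integral 1 ?h x))\<^sup>2) \<partial>lborel)"
      by (rule nn_integral_cmult) measurable
    also have "\<dots> \<le> ennreal (1 / ?d\<^sup>2) * ennreal (?d * L * (\<integral>x. norm (?h x) \<partial>lborel))"
      using fourier_integral_L2_bound[OF hi, of L 1] L
      by (intro mult_left_mono) (auto simp: norm_mult)
    also have "\<dots> = ennreal (L * ?I / ?d)"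
      using nn by (subst ennreal_mult[symmetric]) (auto simp: norm_mult power2_eq_square mult.assoc)
    finally show "(\<integral>\<^sup>+x. ennreal ((norm (inv_fourier ?h x))\<^sup>2) \<partial>lebesgue) \<le> ennreal (L * ?I / ?d)" .
  qed simp
  also have "\<dots> = ennreal ((L * ?I / ?d) powr (1/2))"
    by (rule ennreal_powr_ennreal) (use nn in simp)
  finally show ?thesis .
qed

section \<open>Cubes and slices\<close>

lemma cube_eq_cbox: "cube x r = cbox (\<chi> i. x $ i - r / 2) (\<chi> i. x $ i + r / 2)"
  by (simp only: set_eq_iff cube_def mem_Collect_eq mem_box_cart abs_diff_le_iff) simp

lemma mem_cubeD: "y \<in> cube x r \<Longrightarrow> \<bar>y $ i - x $ i\<bar> \<le> r / 2"
  by (simp add: cube_def)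

lemma emeasure_cube:
  fixes x :: "real^'n"
  assumes "0 \<le> r"
  shows "emeasure lborel (cube x r) = ennreal (r ^ CARD('n))"
proof -
  have "((\<chi> i. x $ i + r / 2) - (\<chi> i. x $ i - r / 2)) \<bullet> b = r" if "b \<in> Basis" for b :: "real^'n"
    using that by (auto simp: Basis_vec_def inner_axis)
  moreover have "(\<chi> i. x $ i - r / 2) \<bullet> b \<le> (\<chi> i. x $ i + r / 2) \<bullet> b" if "b \<in> Basis" for b :: "real^'n"
    using that assms by (auto simp: Basis_vec_def inner_axis)
  ultimately show ?thesis
    unfolding cube_eq_cbox emeasure_lborel_cbox_eq by simp
qed

lemma cube_borel [measurable]: "cube x r \<in> sets borel"
  by (simp add: cube_eq_cbox)

lemma interval_eq: "interval t l = {t - l / 2 .. t + l / 2}"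
  by (simp only: set_eq_iff interval_def mem_Collect_eq atLeastAtMost_iff abs_diff_le_iff) simp

lemma emeasure_lborel_slices:
  fixes A :: "('a::euclidean_space \<times> 'b::euclidean_space) set"
  assumes "A \<in> sets borel"
  shows "emeasure lborel A = (\<integral>\<^sup>+\<tau>. emeasure lborel ((\<lambda>y. (y, \<tau>)) -` A) \<partial>lborel)"
proof -
  have "A \<in> sets (lborel \<Otimes>\<^sub>M lborel)"
    using assms by (simp only: lborel_prod sets_lborel)
  from lborel_pair.emeasure_pair_measure_alt2[OF this] show ?thesis
    by (simp only: lborel_prod)
qed

text \<open>The centre of the slice may depend on the time, so that one estimate serves both a fixed
  cube and the moving cross-section of the tube.\<close>

lemma emeasure_slices_le:
  fixes A :: "((real^'n) \<times> real) set"
  assumes A: "A \<in> sets borel" and "0 \<le> \<rho>" "0 \<le> l"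
    and sub: "\<And>y \<tau>. (y, \<tau>) \<in> A \<Longrightarrow> y \<in> cube (c \<tau>) \<rho> \<and> \<tau> \<in> interval a l"
  shows "emeasure lborel A \<le> ennreal (\<rho> ^ CARD('n) * l)"
proof -
  have "emeasure lborel A = (\<integral>\<^sup>+\<tau>. emeasure lborel ((\<lambda>y. (y, \<tau>)) -` A) \<partial>lborel)"
    using A by (rule emeasure_lborel_slices)
  also have "\<dots> \<le> (\<integral>\<^sup>+\<tau>. ennreal (\<rho> ^ CARD('n)) * indicator (interval a l) \<tau> \<partial>lborel)"
  proof (rule nn_integral_mono)
    fix \<tau>
    show "emeasure lborel ((\<lambda>y. (y, \<tau>)) -` A) \<le> ennreal (\<rho> ^ CARD('n)) * indicator (interval a l) \<tau>"
    proof (cases "\<tau> \<in> interval a l")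
      case True
      have "emeasure lborel ((\<lambda>y. (y, \<tau>)) -` A) \<le> emeasure lborel (cube (c \<tau>) \<rho>)"
        by (rule emeasure_mono) (use sub in auto)
      then show ?thesis using True \<open>0 \<le> \<rho>\<close> by (simp add: emeasure_cube)
    next
      case False
      then have "(\<lambda>y. (y, \<tau>)) -` A = {}" using sub by auto
      then show ?thesis by simp
    qed
  qed
  also have "\<dots> = ennreal (\<rho> ^ CARD('n) * l)"
    using \<open>0 \<le> \<rho>\<close> \<open>0 \<le> l\<close> by (simp add: interval_eq nn_integral_cmult_indicator ennreal_mult)
  finally show ?thesis .
qed

section \<open>The Knapp wave packet\<close>

text \<open>With side \<open>1 / n\<close> a frequency differs from the centre by at most
  \<open>1 / (2 n)\<close> in each coordinate, so its inner product with a vector of coordinates at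
  most 1 is at most \<open>1 / 2\<close> in every dimension.\<close>

definition knapp_datum :: "'n \<Rightarrow> real \<Rightarrow> real^'n \<Rightarrow> complex" where
  "knapp_datum k N = indicator (cube (N *\<^sub>R axis k 1) (1 / real CARD('n)))"

definition knapp_solution :: "'n \<Rightarrow> real \<Rightarrow> (real^'n) \<times> real \<Rightarrow> complex" where
  "knapp_solution k N =
    (\<lambda>(x, t). inv_fourier (\<lambda>\<xi>. cis (- (t * (norm \<xi>)\<^sup>2)) * knapp_datum k N \<xi>) x)"

text \<open>The axis moves with the group velocity \<open>2 N e\<close>, the gradient of the
  dispersion relation \<open>(norm \<xi>)^2\<close> at the frequency \<open>N e\<close>.\<close>

definition knapp_tube :: "'n \<Rightarrow> real \<Rightarrow> ((real^'n) \<times> real) set" where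
  "knapp_tube k N = {(x, t). \<bar>t\<bar> \<le> 1 \<and> x \<in> cube ((2 * t * N) *\<^sub>R axis k 1) 2}"

lemma knapp_tube_borel [measurable]: "knapp_tube k N \<in> sets borel"
proof -
  have "knapp_tube k N = {z. \<bar>snd z\<bar> \<le> 1} \<inter> (\<Inter>i. {z. \<bar>fst z $ i - (2 * snd z * N) * (axis k 1 $ i)\<bar> \<le> 1})"
    by (auto simp: knapp_tube_def cube_def)
  also have "closed \<dots>"
    by (intro closed_Int closed_INT ballI closed_Collect_le continuous_intros)
  finally show ?thesis by (rule borel_closed)
qed

lemma emeasure_knapp_tube: "emeasure lborel (knapp_tube (k::'n::finite) N) = ennreal (2 ^ CARD('n) * 2)"
proof -
  have "emeasure lborel (knapp_tube k N) = (\<integral>\<^sup>+\<tau>. emeasure lborel ((\<lambda>y. (y, \<tau>)) -` knapp_tube k N) \<partial>lborel)"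
    by (rule emeasure_lborel_slices) measurable
  also have "\<dots> = (\<integral>\<^sup>+\<tau>. ennreal (2 ^ CARD('n)) * indicator {-1..1::real} \<tau> \<partial>lborel)"
  proof (rule nn_integral_cong)
    fix \<tau> :: real
    have "(\<lambda>y. (y, \<tau>)) -` knapp_tube k N = (if \<bar>\<tau>\<bar> \<le> 1 then cube ((2 * \<tau> * N) *\<^sub>R axis k 1) 2 else {})"
      by (auto simp: knapp_tube_def)
    moreover have "emeasure lborel (cube ((2 * \<tau> * N) *\<^sub>R axis k 1 :: real^'n) 2) = ennreal (2 ^ CARD('n))"
      by (rule emeasure_cube) simp
    ultimately show "emeasure lborel ((\<lambda>y. (y, \<tau>)) -` knapp_tube k N) = ennreal (2 ^ CARD('n)) * indicator {-1..1} \<tau>"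
      by (auto simp: abs_le_iff indicator_def simp del: ennreal_power)
  qed
  also have "\<dots> = ennreal (2 ^ CARD('n) * 2)"
    by (subst nn_integral_cmult_indicator) (auto simp: ennreal_mult simp del: ennreal_power)
  finally show ?thesis .
qed

lemma knapp_datum_measurable [measurable]: "knapp_datum k N \<in> borel_measurable borel"
  unfolding knapp_datum_def by measurable

lemma norm_knapp_datum_le: "norm (knapp_datum k N \<xi>) \<le> 1"
  by (simp add: knapp_datum_def indicator_def)

lemma norm_knapp_datum:
  "norm (knapp_datum (k::'n::finite) N \<xi>) = indicator (cube (N *\<^sub>R axis k 1) (1 / real CARD('n))) \<xi>"
  by (simp add: knapp_datum_def indicator_def)

lemma integrable_indicator_cube: "0 \<le> r \<Longrightarrow> integrable lborel (indicator (cube x r) :: _ \<Rightarrow> real)"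
  by (subst integrable_indicator_iff) (simp add: emeasure_cube)

lemma integral_indicator_cube:
  "0 \<le> r \<Longrightarrow> integral\<^sup>L lborel (indicator (cube (x :: real^'n) r)) = r ^ CARD('n)"
  by (simp add: emeasure_cube measure_def)

lemma integrable_knapp_datum: "integrable lborel (knapp_datum (k::'n::finite) N)"
  by (rule Bochner_Integration.integrable_bound[OF integrable_indicator_cube[of "1 / real CARD('n)" "N *\<^sub>R axis k 1"]])
    (auto simp: norm_knapp_datum)

lemma knapp_solution_measurable: "knapp_solution k N \<in> borel_measurable borel"
proof -
  have "knapp_solution k N = (\<lambda>z. complex_of_real (1 / (2 * pi) ^ CARD('a)) *
      (\<integral>\<xi>. cis (fst z \<bullet> \<xi>) * (cis (- (snd z * (norm \<xi>)\<^sup>2)) * knapp_datum k N \<xi>) \<partial>lborel))"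
    by (auto simp: knapp_solution_def inv_fourier_eq fourier_integral_def)
  also have "\<dots> \<in> borel_measurable (borel \<Otimes>\<^sub>M borel)"
    by measurable
  finally show ?thesis by (simp only: borel_prod)
qed

text \<open>The phase has modulus one, so the multiplied datum stays integrable and the evolution is
  a function at every time.\<close>

lemma schroedinger_evolution_knapp:
  "schroedinger_evolution (inv_fourier_distribution (knapp_datum k N)) (knapp_solution k N)"
  unfolding schroedinger_evolution_def
proof (intro conjI AE_I2 borel_measurable_lebesgue knapp_solution_measurable)
  fix t
  show "fourier_multiplier (\<lambda>\<xi>. cis (- (t * (norm \<xi>)\<^sup>2))) (inv_fourier_distribution (knapp_datum k N))
      (\<lambda>x. knapp_solution k N (x, t))"
    using fourier_multiplier_inv_fourier_distribution[OF integrable_knapp_datum norm_knapp_datum_le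
        integrable_cis_mult[OF integrable_knapp_datum, where h="\<lambda>\<xi>. - (t * (norm \<xi>)\<^sup>2)"]]
    by (simp add: knapp_solution_def)
qed

section \<open>Lower bound for the evolution on the tube\<close>

lemma abs_inner_le_half:
  fixes y \<eta> :: "real^'n"
  assumes "\<And>i. \<bar>y $ i\<bar> \<le> 1" and "\<And>i. \<bar>\<eta> $ i\<bar> \<le> 1 / (2 * real CARD('n))"
  shows "\<bar>y \<bullet> \<eta>\<bar> \<le> 1 / 2"
proof -
  have "\<bar>y \<bullet> \<eta>\<bar> \<le> (\<Sum>i\<in>UNIV. \<bar>y $ i * \<eta> $ i\<bar>)"
    by (simp add: inner_vec_def)
  also have "\<dots> \<le> (\<Sum>i\<in>(UNIV::'n set). 1 * (1 / (2 * real CARD('n))))"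
    unfolding abs_mult by (intro sum_mono mult_mono assms) auto
  finally show ?thesis by simp
qed

lemma cos_ge_half: "\<bar>x\<bar> \<le> 1 \<Longrightarrow> 1 / 2 \<le> cos (x::real)"
proof -
  assume "\<bar>x\<bar> \<le> 1"
  then have "cos (pi / 3) \<le> cos \<bar>x\<bar>"
    using pi_gt3 by (intro cos_monotone_0_pi_le) auto
  then show ?thesis by (simp add: cos_60)
qed

text \<open>There is no cancellation: once a constant phase is removed, the integrand has real part
  at least \<open>1 / 2\<close> on the frequency cube. The bound is half the volume
  \<open>(1 / n) ^ n\<close> of that cube, times the normalisation of
  \<open>inv_fourier\<close>.\<close>

lemma norm_knapp_solution_ge:
  fixes k :: "'n::finite"
  assumes "(x, t) \<in> knapp_tube k N"
  shows "1 / (2 * (2 * pi * real CARD('n)) ^ CARD('n)) \<le> norm (knapp_solution k N (x, t))"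
proof -
  let ?n = "real CARD('n)" and ?e = "axis k 1 :: real^'n"
  let ?Q = "cube (N *\<^sub>R ?e) (1 / ?n)"
  let ?y = "x - (2 * t * N) *\<^sub>R ?e"
  \<comment> \<open>The phase \<open>x \<bullet> \<xi> - t * (norm \<xi>)^2\<close> at the centre
    \<open>\<xi> = N e\<close>, expressed through \<open>?y\<close>.\<close>
  let ?\<theta> = "N * (?y \<bullet> ?e) + t * N\<^sup>2"
  let ?h = "\<lambda>\<xi>. cis (x \<bullet> \<xi>) * (cis (- (t * (norm \<xi>)\<^sup>2)) * knapp_datum k N \<xi>)"
  have t: "\<bar>t\<bar> \<le> 1" and y: "\<And>i. \<bar>?y $ i\<bar> \<le> 1"
    using assms by (auto simp: knapp_tube_def cube_def)
  have n: "1 \<le> ?n"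
    by (simp add: Suc_leI)
  have h: "integrable lborel ?h"
    by (intro integrable_cis_mult integrable_knapp_datum) auto
  have re: "indicator ?Q \<xi> * (1 / 2) \<le> Re (cis (- ?\<theta>) * ?h \<xi>)" for \<xi>
  proof (cases "\<xi> \<in> ?Q")
    case True
    define \<eta> where "\<eta> = \<xi> - N *\<^sub>R ?e"
    have \<eta>: "\<bar>\<eta> $ i\<bar> \<le> 1 / (2 * ?n)" for i
      using mem_cubeD[OF True, of i] by (simp add: \<eta>_def mult.commute)
    have "1 \<le> 2 * ?n"
      using n by linarith
    then have "1 / (2 * ?n) \<le> 1"
      by (simp only: divide_le_eq_1) simp
    then have \<eta>1: "\<bar>\<eta> $ i\<bar> \<le> 1" for i
      using \<eta>[of i] by linarith
    \<comment> \<open>Galilean invariance: in the moving frame \<open>?y\<close> the phase no longer depends on \<open>N\<close>.\<close>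
    have "x \<bullet> \<xi> - t * (norm \<xi>)\<^sup>2 - ?\<theta> = ?y \<bullet> \<eta> - t * (\<eta> \<bullet> \<eta>)"
      unfolding \<eta>_def power2_norm_eq_inner
      by (simp add: inner_diff_left inner_diff_right inner_axis_axis inner_commute[of ?e]
          algebra_simps power2_eq_square)
    moreover have "\<bar>?y \<bullet> \<eta>\<bar> \<le> 1 / 2" "\<bar>\<eta> \<bullet> \<eta>\<bar> \<le> 1 / 2"
      by (intro abs_inner_le_half y \<eta> \<eta>1)+
    moreover have "\<bar>t * (\<eta> \<bullet> \<eta>)\<bar> \<le> 1 * (1 / 2)"
      unfolding abs_mult by (intro mult_mono t) (use \<open>\<bar>\<eta> \<bullet> \<eta>\<bar> \<le> 1 / 2\<close> in auto)
    ultimately have "\<bar>x \<bullet> \<xi> - t * (norm \<xi>)\<^sup>2 - ?\<theta>\<bar> \<le> 1"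
      by linarith
    then have "1 / 2 \<le> cos (x \<bullet> \<xi> - t * (norm \<xi>)\<^sup>2 - ?\<theta>)"
      by (rule cos_ge_half)
    moreover have "cis (- ?\<theta>) * ?h \<xi> = cis (x \<bullet> \<xi> - t * (norm \<xi>)\<^sup>2 - ?\<theta>)"
      using True by (simp add: knapp_datum_def cis_mult algebra_simps)
    ultimately show ?thesis
      using True by simp
  next
    case False
    then show ?thesis by (simp add: knapp_datum_def)
  qed
  have "1 / 2 * (1 / ?n) ^ CARD('n) = (\<integral>\<xi>. indicator ?Q \<xi> * (1 / 2) \<partial>lborel)"
    by (subst integral_mult_left_zero, subst integral_indicator_cube) auto
  also have "\<dots> \<le> (\<integral>\<xi>. Re (cis (- ?\<theta>) * ?h \<xi>) \<partial>lborel)"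
    by (intro integral_mono re integrable_mult_left integrable_indicator_cube integrable_Re
        integrable_mult_right h) auto
  also have "\<dots> = Re (cis (- ?\<theta>) * integral\<^sup>L lborel ?h)"
    using h by (subst integral_Re) (auto intro: integrable_mult_right simp: integral_mult_right_zero)
  also have "\<dots> \<le> norm (cis (- ?\<theta>) * integral\<^sup>L lborel ?h)"
    by (rule complex_Re_le_cmod)
  also have "\<dots> = norm (integral\<^sup>L lborel ?h)"
    by (simp add: norm_mult)
  finally have "1 / 2 * (1 / ?n) ^ CARD('n) \<le> norm (integral\<^sup>L lborel ?h)" .
  moreover have "norm (knapp_solution k N (x, t)) = norm (integral\<^sup>L lborel ?h) / (2 * pi) ^ CARD('n)"
    by (simp add: knapp_solution_def inv_fourier_eq fourier_integral_def norm_mult norm_divide norm_power)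
  moreover have "1 / (2 * (2 * pi * ?n) ^ CARD('n)) = (1 / 2 * (1 / ?n) ^ CARD('n)) / (2 * pi) ^ CARD('n)"
    by (simp add: power_mult_distrib power_divide field_simps)
  ultimately show ?thesis
    by (simp only:) (intro divide_right_mono, auto)
qed

text \<open>The pointwise bound is squared and integrated over the tube; since the tube has measure
  at least 1, the same constant survives the square root.\<close>

lemma L2_norm_knapp_ge:
  fixes k :: "'n::finite"
  shows "ennreal (1 / (2 * (2 * pi * real CARD('n)) ^ CARD('n)))
    \<le> L2_norm (density lebesgue (\<lambda>z. ennreal (indicator (knapp_tube k N) z))) (knapp_solution k N)"
proof -
  let ?T = "knapp_tube k N" and ?u = "knapp_solution k N"
  let ?c = "1 / (2 * (2 * pi * real CARD('n)) ^ CARD('n))"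
  have c: "0 \<le> ?c" by simp
  note [measurable] = knapp_solution_measurable[of k N]
  have "ennreal (?c\<^sup>2) \<le> ennreal (?c\<^sup>2) * emeasure lborel ?T"
  proof -
    have "1 \<le> (2::real) ^ CARD('n) * 2"
      using one_le_power[of "2::real" "CARD('n)"] by linarith
    then have "?c\<^sup>2 * 1 \<le> ?c\<^sup>2 * (2 ^ CARD('n) * 2)"
      by (intro mult_left_mono) auto
    then show ?thesis
      unfolding emeasure_knapp_tube by (subst ennreal_mult[symmetric]) (auto intro: ennreal_leI)
  qed
  also have "\<dots> = (\<integral>\<^sup>+z. ennreal (?c\<^sup>2) * indicator ?T z \<partial>lborel)"
    by (rule nn_integral_cmult_indicator[symmetric]) simp
  also have "\<dots> \<le> (\<integral>\<^sup>+z. ennreal (indicator ?T z) * ennreal ((norm (?u z))\<^sup>2) \<partial>lborel)"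
  proof (rule nn_integral_mono)
    fix z
    show "ennreal (?c\<^sup>2) * indicator ?T z \<le> ennreal (indicator ?T z) * ennreal ((norm (?u z))\<^sup>2)"
    proof (cases "z \<in> ?T")
      case True
      then have "?c \<le> norm (?u z)"
        using norm_knapp_solution_ge by (cases z) auto
      then have "?c\<^sup>2 \<le> (norm (?u z))\<^sup>2"
        by (rule power_mono[OF _ c])
      then show ?thesis using True by (simp add: ennreal_leI)
    qed simp
  qed
  also have "\<dots> = (\<integral>\<^sup>+z. ennreal (indicator ?T z) * ennreal ((norm (?u z))\<^sup>2) \<partial>lebesgue)"
    by (simp only: nn_integral_completion)
  also have "\<dots> = (\<integral>\<^sup>+z. ennreal ((norm (?u z))\<^sup>2) \<partial>density lebesgue (\<lambda>z. ennreal (indicator ?T z)))"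
    by (subst nn_integral_density) (auto intro!: borel_measurable_lebesgue)
  finally have "ennreal_powr (ennreal (?c\<^sup>2)) (1/2) \<le> L2_norm (density lebesgue (\<lambda>z. ennreal (indicator ?T z))) ?u"
    unfolding L2_norm_def by (rule ennreal_powr_mono) simp
  moreover have "ennreal_powr (ennreal (?c\<^sup>2)) (1/2) = ennreal ?c"
    by (subst ennreal_powr_ennreal) (simp_all add: powr_half_sqrt)
  ultimately show ?thesis by simp
qed

text \<open>The cube lies within distance \<open>1 / 2\<close> of \<open>N e\<close>. Both bounds
  are wanted: \<open>norm \<xi> powr s\<close> is controlled by the upper one for
  \<open>s \<ge> 0\<close> and by the lower one for \<open>s < 0\<close>.\<close>

lemma norm_cube_bounds:
  fixes k :: "'n::finite"
  assumes "1 \<le> N" and "\<xi> \<in> cube (N *\<^sub>R axis k 1) (1 / real CARD('n))"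
  shows "N / 2 \<le> norm \<xi>" and "norm \<xi> \<le> 2 * N"
proof -
  let ?v = "N *\<^sub>R axis k 1 :: real^'n"
  have "norm (\<xi> - ?v) \<le> (\<Sum>i\<in>UNIV. \<bar>(\<xi> - ?v) $ i\<bar>)"
    by (rule norm_le_l1_cart)
  also have "\<dots> \<le> (\<Sum>i\<in>(UNIV::'n set). 1 / (2 * real CARD('n)))"
  proof (rule sum_mono)
    fix i
    show "\<bar>(\<xi> - ?v) $ i\<bar> \<le> 1 / (2 * real CARD('n))"
      using mem_cubeD[OF assms(2), of i] by (simp add: mult.commute)
  qed
  finally have "norm (\<xi> - ?v) \<le> 1 / 2" by simp
  moreover have "norm ?v = N"
    using assms(1) by (simp add: norm_axis_1)
  ultimately show "N / 2 \<le> norm \<xi>" "norm \<xi> \<le> 2 * N"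
    using assms(1) norm_triangle_ineq2[of ?v \<xi>] norm_triangle_ineq2[of \<xi> ?v]
    by (simp_all add: norm_minus_commute)
qed

lemma norm_powr_cube_le:
  fixes k :: "'n::finite"
  assumes "1 \<le> N" and "\<xi> \<in> cube (N *\<^sub>R axis k 1) (1 / real CARD('n))"
  shows "norm \<xi> powr s \<le> 2 powr \<bar>s\<bar> * N powr s"
proof (cases "0 \<le> s")
  case True
  then have "norm \<xi> powr s \<le> (2 * N) powr s"
    using norm_cube_bounds[OF assms] by (intro powr_mono2) auto
  then show ?thesis using True assms(1) by (simp add: powr_mult)
next
  case False
  then have "norm \<xi> powr s \<le> (N / 2) powr s"
    using norm_cube_bounds[OF assms] assms(1) by (intro powr_mono2') auto
  then show ?thesis using False assms(1) by (simp add: powr_divide powr_minus_divide)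
qed

text \<open>The frequency cube has volume at most 1, so the supremum bound \<open>?L\<close> also
  bounds the \<open>L1\<close> norm, and the square root of their product is again
  \<open>?L\<close>.\<close>

lemma sobolev_norm_knapp_le:
  fixes k :: "'n::finite"
  assumes N: "1 \<le> N"
  shows "sobolev_norm s (inv_fourier_distribution (knapp_datum k N)) \<le> ennreal (2 powr \<bar>s\<bar> * N powr s)"
proof -
  let ?Q = "cube (N *\<^sub>R axis k 1 :: real^'n) (1 / real CARD('n))"
  let ?L = "2 powr \<bar>s\<bar> * N powr s"
  let ?f = "\<lambda>\<xi>. norm \<xi> powr s * norm (knapp_datum k N \<xi>)"
  have le: "?f \<xi> \<le> ?L * indicator ?Q \<xi>" for \<xi>
    unfolding norm_knapp_datum by (cases "\<xi> \<in> ?Q") (auto intro: norm_powr_cube_le[OF N])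
  have leL: "?f \<xi> \<le> ?L" for \<xi>
    by (rule order_trans[OF le]) (simp add: indicator_def)
  have Q: "integrable lborel (\<lambda>\<xi>. ?L * indicator ?Q \<xi>)"
    by (intro integrable_mult_right integrable_indicator_cube) simp
  have f: "integrable lborel ?f"
    by (rule Bochner_Integration.integrable_bound[OF Q])
      (auto intro!: AE_I2 order_trans[OF le] simp: abs_mult)
  have "integral\<^sup>L lborel ?f \<le> (\<integral>\<xi>. ?L * indicator ?Q \<xi> \<partial>lborel)"
    by (intro integral_mono f Q le)
  also have "\<dots> = ?L * (1 / real CARD('n)) ^ CARD('n)"
    by (subst integral_mult_right_zero, subst integral_indicator_cube) auto
  also have "\<dots> \<le> ?L * 1"
    by (intro mult_left_mono power_le_one) (auto simp: divide_simps Suc_leI)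
  finally have I: "integral\<^sup>L lborel ?f \<le> ?L" by simp
  have "1 \<le> (2 * pi) ^ CARD('n)"
    using pi_gt3 by (intro one_le_power) auto
  then have "?L * integral\<^sup>L lborel ?f / (2 * pi) ^ CARD('n) \<le> ?L * integral\<^sup>L lborel ?f / 1"
    by (intro divide_left_mono) auto
  also have "\<dots> \<le> ?L\<^sup>2"
    unfolding power2_eq_square div_by_1 by (intro mult_left_mono I) simp
  finally have "(?L * integral\<^sup>L lborel ?f / (2 * pi) ^ CARD('n)) powr (1/2) \<le> ?L\<^sup>2 powr (1/2)"
    by (intro powr_mono2) auto
  also have "?L\<^sup>2 powr (1/2) = ?L"
    by (subst powr_half_sqrt) (simp_all only: zero_le_power2 real_sqrt_abs, simp)
  finally show ?thesis
    by (intro order_trans[OF sobolev_norm_inv_fourier_distribution_le[OF integrable_knapp_datum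
          norm_knapp_datum_le f leL]] ennreal_leI)
qed

section \<open>The Morrey norm of the tube\<close>

text \<open>Here \<open>m\<close> stands for the measure of the part of the tube in a parabolic
  cylinder of size \<open>r\<close>. It is bounded by the whole cylinder (\<open>m1\<close>), by the
  crossing time times the section of the cylinder (\<open>m2\<close>) or of the tube
  (\<open>m3\<close>), and by the whole tube (\<open>m4\<close>). On each range of \<open>r\<close>
  the resulting power of \<open>r\<close> is monotone, hence largest at an end:
  \<open>r = N powr (-1/2)\<close>, \<open>r = 1\<close> and \<open>r = N\<close> yield
  \<open>N powr (- \<beta> / 2)\<close>, \<open>N powr -1\<close> and
  \<open>N powr (\<beta> - n - 2)\<close>.\<close>

lemma tube_scale_bound:
  fixes r N \<beta> m :: real
  assumes N: "1 \<le> N" and r: "0 < r" and \<beta>: "0 < \<beta>" "\<beta> \<le> real n + 2" and m: "0 \<le> m"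
    and m1: "m \<le> r ^ n * r\<^sup>2" and m2: "m \<le> r ^ n * ((r + 2) / (2 * N))"
    and m3: "m \<le> 2 ^ n * ((r + 2) / (2 * N))" and m4: "m \<le> 2 ^ n * 2"
  shows "r powr (\<beta> - real n - 2) * m
    \<le> 2 ^ (n + 1) * (N powr -1 + N powr (- \<beta> / 2) + N powr (\<beta> - real n - 2))"
proof -
  let ?S = "N powr -1 + N powr (- \<beta> / 2) + N powr (\<beta> - real n - 2)"
  let ?q = "\<beta> - real n - 2"
  have S: "0 \<le> ?S" by (intro add_nonneg_nonneg) auto
  have K: "(2::real) \<le> 2 ^ (n + 1)" by simp
  have N1: "N powr -1 = 1 / N"
    using N by (simp add: powr_minus_divide)
  have r2: "r powr 2 = r\<^sup>2"
    using r by (simp add: powr_numeral)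
  have rn: "r powr ?q * r ^ n = r powr (\<beta> - 2)"
    using r by (simp add: powr_realpow[symmetric] powr_add[symmetric])
  \<comment> \<open>The thresholds are the scales, up to constants, at which \<open>r^2\<close>
    reaches the crossing time \<open>1 / N\<close>, the cube reaches the width of the tube, and the
    cube reaches its spatial length.\<close>
  consider "r \<le> N powr (-1/2)" | "N powr (-1/2) \<le> r" "r \<le> 1" | "1 \<le> r" "r \<le> N" | "N \<le> r"
    by linarith
  then show ?thesis
  proof cases
    case 1
    have "r powr ?q * m \<le> r powr ?q * (r ^ n * r\<^sup>2)"
      by (intro mult_left_mono m1) simp
    also have "\<dots> = r powr (\<beta> - 2) * r\<^sup>2"
      by (subst rn[symmetric]) (rule mult.assoc[symmetric])
    also have "\<dots> = r powr \<beta>"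
      by (simp only: r2[symmetric] powr_add[symmetric] diff_add_cancel)
    also have "\<dots> \<le> (N powr (-1/2)) powr \<beta>"
      using 1 r \<beta> by (intro powr_mono2) auto
    also have "\<dots> = 1 * N powr (- \<beta> / 2)"
      by (simp add: powr_powr)
    also have "\<dots> \<le> 2 ^ (n + 1) * ?S"
      by (intro mult_mono one_le_power) (use S in auto)
    finally show ?thesis .
  next
    case 2
    have "r powr ?q * m \<le> r powr ?q * (r ^ n * ((r + 2) / (2 * N)))"
      by (intro mult_left_mono m2) simp
    also have "\<dots> = r powr (\<beta> - 2) * ((r + 2) / (2 * N))"
      by (subst rn[symmetric]) (rule mult.assoc[symmetric])
    also have "\<dots> \<le> r powr (\<beta> - 2) * (2 * (1 / N))"
      using 2 N r by (intro mult_left_mono) (auto simp: field_simps)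
    also have "\<dots> \<le> 2 * ?S"
    proof (cases "2 \<le> \<beta>")
      case True
      then have "r powr (\<beta> - 2) \<le> 1"
        using 2 r by (intro powr_le1) auto
      then have "r powr (\<beta> - 2) * (2 * (1 / N)) \<le> 1 * (2 * (1 / N))"
        using N by (intro mult_right_mono) auto
      also have "\<dots> \<le> 2 * ?S"
        unfolding N1 by simp
      finally show ?thesis .
    next
      case False
      have "r powr (\<beta> - 2) \<le> (N powr (-1/2)) powr (\<beta> - 2)"
        using False 2 N by (intro powr_mono2') auto
      also have "\<dots> = N powr (1 - \<beta> / 2)"
        by (simp add: powr_powr diff_divide_distrib algebra_simps)
      finally have "r powr (\<beta> - 2) * (2 * (1 / N)) \<le> N powr (1 - \<beta> / 2) * (2 * N powr -1)"
        unfolding N1 using N by (intro mult_right_mono) auto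
      also have "\<dots> = 2 * N powr (- \<beta> / 2)"
      proof -
        have "N powr (1 - \<beta> / 2) * N powr -1 = N powr (- \<beta> / 2)"
          by (simp only: powr_add[symmetric]) simp
        then show ?thesis by (simp only: mult.left_commute)
      qed
      also have "\<dots> \<le> 2 * ?S" by simp
      finally show ?thesis .
    qed
    also have "\<dots> \<le> 2 ^ (n + 1) * ?S"
      by (intro mult_right_mono K S)
    finally show ?thesis .
  next
    case 3
    have "r powr ?q * m \<le> r powr ?q * (2 ^ n * ((r + 2) / (2 * N)))"
      by (intro mult_left_mono m3) simp
    also have "\<dots> \<le> r powr ?q * (2 ^ n * (2 * (r / N)))"
      using 3 N by (intro mult_left_mono) (auto simp: field_simps)
    also have "\<dots> = 2 ^ (n + 1) * (r powr (\<beta> - real n - 1) * (1 / N))"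
    proof -
      have "r powr (\<beta> - real n - 1) = r powr ?q * r powr 1"
        by (subst powr_add[symmetric]) (simp add: algebra_simps)
      then show ?thesis using r by simp
    qed
    also have "\<dots> \<le> 2 ^ (n + 1) * ?S"
    proof (rule mult_left_mono)
      show "r powr (\<beta> - real n - 1) * (1 / N) \<le> ?S"
      proof (cases "\<beta> \<le> real n + 1")
        case True
        then have "r powr (\<beta> - real n - 1) \<le> r powr 0"
          using 3 by (intro powr_mono) auto
        then have "r powr (\<beta> - real n - 1) * (1 / N) \<le> 1 * (1 / N)"
          using r N by (intro mult_right_mono) auto
        also have "\<dots> \<le> ?S" unfolding N1 by simp
        finally show ?thesis .
      next
        case False
        then have "r powr (\<beta> - real n - 1) \<le> N powr (\<beta> - real n - 1)"
          using 3 by (intro powr_mono2) auto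
        then have "r powr (\<beta> - real n - 1) * (1 / N) \<le> N powr (\<beta> - real n - 1) * N powr -1"
          unfolding N1 using N by (intro mult_right_mono) auto
        also have "\<dots> = N powr ?q"
          by (simp only: powr_add[symmetric]) simp
        also have "\<dots> \<le> ?S" by simp
        finally show ?thesis .
      qed
    qed simp
    finally show ?thesis .
  next
    case 4
    \<comment> \<open>The exponent \<open>?q\<close> is nonpositive because
      \<open>\<beta> \<le> n + 2\<close>, so large cylinders are no worse than
      \<open>r = N\<close>.\<close>
    have "r powr ?q * m \<le> N powr ?q * (2 ^ n * 2)"
      using 4 N \<beta> m by (intro mult_mono m4 powr_mono2') auto
    also have "\<dots> \<le> ?S * (2 ^ n * 2)"
      by (intro mult_right_mono) auto
    finally show ?thesis by (simp add: ac_simps)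
  qed
qed

lemma morrey_norm_knapp_le:
  fixes k :: "'n::finite"
  assumes N: "1 \<le> N" and p: "0 < p" and \<alpha>: "0 < \<alpha>" "\<alpha> * p \<le> real CARD('n) + 2"
  shows "morrey_norm 2 \<alpha> p (indicator (knapp_tube k N))
    \<le> ennreal ((2 ^ (CARD('n) + 1)
        * (N powr -1 + N powr (- (\<alpha> * p) / 2) + N powr (\<alpha> * p - real CARD('n) - 2))) powr (1 / p))"
    (is "_ \<le> ennreal (?R powr (1 / p))")
  unfolding morrey_norm_def
proof (rule SUP_least, clarify)
  fix x :: "real^'n" and t r :: real
  assume r: "0 < r"
  let ?n = "CARD('n)" and ?T = "knapp_tube k N"
  let ?A = "?T \<inter> (cube x r \<times> interval t (r powr 2))"
  have r2: "r powr 2 = r\<^sup>2"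
    using r by (simp add: powr_numeral)
  have A: "?A \<in> sets borel"
    by (intro sets.Int knapp_tube_borel borel_closed closed_Times) (simp_all add: cube_eq_cbox interval_eq closed_cbox)
  define m where "m = measure lborel ?A"
  have slice: "emeasure lborel ?A \<le> ennreal (\<rho> ^ ?n * l)"
    if "0 \<le> \<rho>" "0 \<le> l" "\<And>y \<tau>. (y, \<tau>) \<in> ?A \<Longrightarrow> y \<in> cube (c \<tau>) \<rho> \<and> \<tau> \<in> interval a l" for \<rho> l c a
    using A that by (rule emeasure_slices_le)
  have sT: "y \<in> cube ((2 * \<tau> * N) *\<^sub>R axis k 1) 2" "\<tau> \<in> interval 0 2" if "(y, \<tau>) \<in> ?A" for y \<tau>
    using that by (auto simp: knapp_tube_def interval_def)
  have sQ: "y \<in> cube x r" "\<tau> \<in> interval t (r\<^sup>2)" if "(y, \<tau>) \<in> ?A" for y \<tau>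
    using that r2 by auto
  \<comment> \<open>Along the axis \<open>k\<close>, the point \<open>2 * \<tau> * N\<close> is
    within 1 of \<open>y $ k\<close>, which is within \<open>r / 2\<close> of \<open>x $ k\<close>;
    dividing by \<open>2 * N\<close> gives half the length of the interval.\<close>
  have sN: "\<tau> \<in> interval (x $ k / (2 * N)) ((r + 2) / (2 * N))" if "(y, \<tau>) \<in> ?A" for y \<tau>
  proof -
    have b: "\<bar>y $ k - 2 * \<tau> * N\<bar> \<le> 1"
      using mem_cubeD[OF sT(1)[OF that], of k] by simp
    have "\<bar>2 * \<tau> * N - x $ k\<bar> = \<bar>(y $ k - x $ k) - (y $ k - 2 * \<tau> * N)\<bar>"
      by simp
    also have "\<dots> \<le> \<bar>y $ k - x $ k\<bar> + \<bar>y $ k - 2 * \<tau> * N\<bar>"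
      by (rule abs_triangle_ineq4)
    also have "\<dots> \<le> r / 2 + 1"
      by (intro add_mono b mem_cubeD sQ(1)[OF that])
    also have "\<dots> = (r + 2) / 2"
      by (simp add: add_divide_distrib)
    finally have "\<bar>2 * \<tau> * N - x $ k\<bar> \<le> (r + 2) / 2" .
    then have "\<bar>2 * \<tau> * N - x $ k\<bar> / (2 * N) \<le> (r + 2) / 2 / (2 * N)"
      using N by (intro divide_right_mono) auto
    also have "\<bar>2 * \<tau> * N - x $ k\<bar> / (2 * N) = \<bar>\<tau> - x $ k / (2 * N)\<bar>"
    proof -
      have "\<tau> - x $ k / (2 * N) = (2 * \<tau> * N - x $ k) / (2 * N)"
        using N by (simp add: diff_divide_distrib)
      then show ?thesis using N by (simp add: abs_divide)
    qed
    finally show ?thesis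
      by (simp only: interval_def mem_Collect_eq) (simp add: field_simps)
  qed
  have l: "0 \<le> (r + 2) / (2 * N)" using r N by simp
  have e1: "emeasure lborel ?A \<le> ennreal (r ^ ?n * r\<^sup>2)"
    using r sQ by (intro slice[where c = "\<lambda>_. x"]) auto
  have e2: "emeasure lborel ?A \<le> ennreal (r ^ ?n * ((r + 2) / (2 * N)))"
    using r l sQ(1) sN by (intro slice[where c = "\<lambda>_. x"]) auto
  have e3: "emeasure lborel ?A \<le> ennreal (2 ^ ?n * ((r + 2) / (2 * N)))"
    using l sT(1) sN by (intro slice[where c = "\<lambda>\<tau>. (2 * \<tau> * N) *\<^sub>R axis k 1"]) auto
  have e4: "emeasure lborel ?A \<le> ennreal (2 ^ ?n * 2)"
    using sT by (intro slice[where c = "\<lambda>\<tau>. (2 * \<tau> * N) *\<^sub>R axis k 1"]) auto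
  have em: "emeasure lborel ?A = ennreal m"
    unfolding m_def using e1 by (intro emeasure_eq_ennreal_measure) (auto simp: top_unique)
  have m0: "0 \<le> m" by (simp add: m_def)
  have m_le: "m \<le> X" if "emeasure lborel ?A \<le> ennreal X" "0 \<le> X" for X
    using that unfolding em by (simp only: ennreal_le_iff)
  have main: "r powr (\<alpha> * p - real ?n - 2) * m \<le> ?R"
    by (intro tube_scale_bound N r m0 \<alpha> mult_pos_pos p m_le e1 e2 e3 e4 mult_nonneg_nonneg l) (use r in auto)
  have "(\<integral>\<^sup>+ z \<in> cube x r \<times> interval t (r powr 2). ennreal (indicator ?T z powr p) \<partial>lebesgue)
      = (\<integral>\<^sup>+ z. indicator ?A z \<partial>lborel)"
    unfolding nn_integral_completion using p by (intro nn_integral_cong) (auto simp: indicator_def)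
  also have "\<dots> = ennreal m"
    using A em by (subst nn_integral_indicator) auto
  finally have I: "(\<integral>\<^sup>+ z \<in> cube x r \<times> interval t (r powr 2). ennreal (indicator ?T z powr p) \<partial>lebesgue) = ennreal m" .
  \<comment> \<open>Taking \<open>r powr \<alpha>\<close> under the \<open>p\<close>-th root turns
    it into \<open>r powr (\<alpha> * p)\<close>, so the scale bound applies with
    \<open>\<beta> = \<alpha> * p\<close>.\<close>
  have "ennreal (r powr \<alpha>) * ennreal_powr (ennreal (1 / r powr (real ?n + 2)) * ennreal m) (1 / p)
      = ennreal (r powr \<alpha> * (1 / r powr (real ?n + 2) * m) powr (1 / p))"
    using m0 by (simp add: ennreal_powr_ennreal ennreal_mult[symmetric])
  also have "r powr \<alpha> * (1 / r powr (real ?n + 2) * m) powr (1 / p)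
      = (r powr (\<alpha> * p) * (1 / r powr (real ?n + 2) * m)) powr (1 / p)"
    by (subst powr_mult[of "r powr (\<alpha> * p)"]) (use m0 p in \<open>simp_all add: powr_powr\<close>)
  also have "r powr (\<alpha> * p) * (1 / r powr (real ?n + 2) * m) = r powr (\<alpha> * p - real ?n - 2) * m"
    using r by (simp add: powr_diff powr_add)
  also have "ennreal ((r powr (\<alpha> * p - real ?n - 2) * m) powr (1 / p)) \<le> ennreal (?R powr (1 / p))"
    using p m0 by (intro ennreal_leI powr_mono2 main) auto
  finally show "ennreal (r powr \<alpha>) * ennreal_powr (ennreal (1 / r powr (real ?n + 2)) *
        (\<integral>\<^sup>+ z \<in> cube x r \<times> interval t (r powr 2). ennreal (indicator ?T z powr p) \<partial>lebesgue)) (1 / p)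
      \<le> ennreal (?R powr (1 / p))"
    unfolding I .
qed

section \<open>Testing the estimate on the packets as the frequency \<open>N\<close> tends to
  infinity\<close>

theorem proposition1p3:
  fixes s p :: real
  assumes "-1 < s" and "s < real CARD('n::finite) / 4"
    and "1 \<le> p" and "p \<le> (real CARD('n) + 2) / (2 * s + 2)"
    and "1 / p > (4 * s + 2) / (real CARD('n) + 2)" and "1 / p > 2 * s"
  shows "\<not> (\<exists>C::real. \<forall>w \<in> morrey_class 2 (2 * s + 2) p.
             \<forall>f \<in> (sobolev_space s :: ((real^'n \<Rightarrow> complex) \<Rightarrow> complex) set).
             \<forall>u. schroedinger_evolution f u \<longrightarrow>
               L2_norm (density lebesgue (\<lambda>z. ennreal (w z))) u
                 \<le> ennreal C * ennreal_powr (morrey_norm 2 (2 * s + 2) p w) (1/2) * sobolev_norm s f)"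
proof
  let ?n = "real CARD('n)" and ?\<alpha> = "2 * s + 2"
  let ?\<beta> = "?\<alpha> * p"
  have p: "0 < p" and \<alpha>: "0 < ?\<alpha>" using assms by auto
  have \<beta>: "?\<beta> \<le> ?n + 2"
    using assms(4) \<alpha> by (simp add: pos_le_divide_eq mult.commute)
  have sp1: "2 * s * p < 1"
    using assms(6) p by (simp add: pos_less_divide_eq)
  have sp2: "(4 * s + 2) * p < ?n + 2"
    using assms(5) p by (simp add: divide_simps mult.commute)
  have "s < 1"
  proof -
    have "1 / p \<le> 1" using assms(3) by simp
    then show ?thesis using assms(6) by linarith
  qed
  then have sp3: "s * p < p" using p by simp
  assume "\<exists>C::real. \<forall>w \<in> morrey_class 2 ?\<alpha> p.
             \<forall>f \<in> (sobolev_space s :: ((real^'n \<Rightarrow> complex) \<Rightarrow> complex) set).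
             \<forall>u. schroedinger_evolution f u \<longrightarrow>
               L2_norm (density lebesgue (\<lambda>z. ennreal (w z))) u
                 \<le> ennreal C * ennreal_powr (morrey_norm 2 ?\<alpha> p w) (1/2) * sobolev_norm s f"
  then obtain C where C: "\<And>w f u. \<lbrakk>w \<in> morrey_class 2 ?\<alpha> p;
      f \<in> (sobolev_space s :: ((real^'n \<Rightarrow> complex) \<Rightarrow> complex) set); schroedinger_evolution f u\<rbrakk> \<Longrightarrow>
      L2_norm (density lebesgue (\<lambda>z. ennreal (w z))) u
        \<le> ennreal C * ennreal_powr (morrey_norm 2 ?\<alpha> p w) (1/2) * sobolev_norm s f"
    by blast
  define c where "c = 1 / (2 * (2 * pi * ?n) ^ CARD('n))"
  define R where "R N = 2 ^ (CARD('n) + 1) * (N powr -1 + N powr (- ?\<beta> / 2) + N powr (?\<beta> - ?n - 2))" for N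
  have R0: "0 \<le> R N" for N
    unfolding R_def by (intro mult_nonneg_nonneg add_nonneg_nonneg) auto
  \<comment> \<open>\<open>ennreal C\<close> truncates a negative \<open>C\<close> to 0, hence
    \<open>max C 0\<close>. The exponent \<open>1 / (2 * p)\<close> combines the root in the Morrey
    norm with the square root in the estimate; writing \<open>N powr s\<close> as the same power of
    \<open>N powr (2 * s * p)\<close> merges the Sobolev and Morrey factors.\<close>
  have le: "c \<le> max C 0 * (2 powr \<bar>s\<bar> * (N powr (2 * s * p) * R N) powr (1 / (2 * p)))" if N: "1 \<le> N" for N
  proof -
    \<comment> \<open>Any coordinate axis will do as the direction of travel.\<close>
    let ?k = "undefined :: 'n"
    let ?w = "indicator (knapp_tube ?k N) :: (real^'n) \<times> real \<Rightarrow> real"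
    let ?f = "inv_fourier_distribution (knapp_datum ?k N)"
    have mn: "morrey_norm 2 ?\<alpha> p ?w \<le> ennreal (R N powr (1 / p))"
      unfolding R_def by (rule morrey_norm_knapp_le[OF N p \<alpha> \<beta>])
    have sn: "sobolev_norm s ?f \<le> ennreal (2 powr \<bar>s\<bar> * N powr s)"
      by (rule sobolev_norm_knapp_le[OF N])
    have "?w \<in> morrey_class 2 ?\<alpha> p"
      unfolding morrey_class_def
      using le_less_trans[OF mn ennreal_less_top] by (auto intro: borel_measurable_lebesgue)
    moreover have "?f \<in> sobolev_space s"
      unfolding sobolev_space_def
      using le_less_trans[OF sn ennreal_less_top]
      by (auto intro: tempered_inv_fourier_distribution integrable_knapp_datum)
    ultimately have "ennreal c \<le> ennreal C * ennreal_powr (morrey_norm 2 ?\<alpha> p ?w) (1/2) * sobolev_norm s ?f"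
      unfolding c_def using C[OF _ _ schroedinger_evolution_knapp] L2_norm_knapp_ge order_trans by blast
    also have "\<dots> \<le> ennreal (max C 0) * ennreal_powr (ennreal (R N powr (1 / p))) (1/2)
        * ennreal (2 powr \<bar>s\<bar> * N powr s)"
      by (intro mult_mono ennreal_leI ennreal_powr_mono mn sn) auto
    also have "\<dots> = ennreal (max C 0 * R N powr (1 / (2 * p)) * (2 powr \<bar>s\<bar> * N powr s))"
      by (simp add: ennreal_powr_ennreal powr_powr ennreal_mult mult.commute[of p])
    also have "max C 0 * R N powr (1 / (2 * p)) * (2 powr \<bar>s\<bar> * N powr s)
        = max C 0 * (2 powr \<bar>s\<bar> * (N powr (2 * s * p) * R N) powr (1 / (2 * p)))"
      using p R0[of N] by (simp add: powr_mult powr_powr)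
    finally show ?thesis
      by (subst (asm) ennreal_le_iff) (auto intro!: mult_nonneg_nonneg)
  qed
  have "((\<lambda>N. max C 0 * (2 powr \<bar>s\<bar> * (N powr (2 * s * p) * R N) powr (1 / (2 * p)))) \<longlongrightarrow>
      max C 0 * (2 powr \<bar>s\<bar> * 0)) at_top"
  proof (intro tendsto_mult tendsto_const)
    \<comment> \<open>The three exponents are negative by \<open>sp1\<close>, \<open>sp3\<close> and
      \<open>sp2\<close> respectively.\<close>
    have e: "N powr (2 * s * p) * R N
      = 2 ^ (CARD('n) + 1) * (N powr (2 * s * p - 1) + N powr (s * p - p) + N powr ((4 * s + 2) * p - ?n - 2))" for N
    proof -
      have a: "N powr (2 * s * p) * N powr x = N powr y" if "2 * s * p + x = y" for x y
        using that by (simp only: powr_add[symmetric])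
      have "N powr (2 * s * p) * R N = 2 ^ (CARD('n) + 1) * (N powr (2 * s * p) * N powr -1
          + N powr (2 * s * p) * N powr (- ?\<beta> / 2) + N powr (2 * s * p) * N powr (?\<beta> - ?n - 2))"
        unfolding R_def by (simp only: distrib_left mult.left_commute)
      also have "N powr (2 * s * p) * N powr -1 = N powr (2 * s * p - 1)"
        by (rule a) simp
      also have "N powr (2 * s * p) * N powr (- ?\<beta> / 2) = N powr (s * p - p)"
        by (rule a) (simp add: field_simps)
      also have "N powr (2 * s * p) * N powr (?\<beta> - ?n - 2) = N powr ((4 * s + 2) * p - ?n - 2)"
        by (rule a) (simp add: algebra_simps)
      finally show ?thesis .
    qed
    have "((\<lambda>N. N powr (2 * s * p) * R N) \<longlongrightarrow> 2 ^ (CARD('n) + 1) * (0 + 0 + 0)) at_top"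
      unfolding e using sp1 sp2 sp3
      by (intro tendsto_intros tendsto_neg_powr filterlim_ident) auto
    then have z: "((\<lambda>N. N powr (2 * s * p) * R N) \<longlongrightarrow> 0) at_top" by simp
    show "((\<lambda>N. (N powr (2 * s * p) * R N) powr (1 / (2 * p))) \<longlongrightarrow> 0) at_top"
      by (rule tendsto_zero_powrI[OF z tendsto_const]) (use p R0 in \<open>auto intro!: always_eventually\<close>)
  qed
  \<comment> \<open>The lower bound \<open>c\<close> does not involve \<open>N\<close>, so it passes
    to the limit.\<close>
  then have "c \<le> max C 0 * (2 powr \<bar>s\<bar> * 0)"
    by (rule tendsto_lowerbound) (auto intro!: eventually_at_top_linorderI[of 1] le)
  moreover have "0 < c"
    unfolding c_def by simp
  ultimately show False by simp
qed

end
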